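(* Every connected diamond-free claw-free cubic graph on fewer than $18$ vertices, other than the triangular prism, is strongly $6$-edge-colorable. Hence the $18$-vertex graph $H$ has the minimum number of vertices among connected diamond-free claw-free cubic graphs, other than the triangular prism, with strong chromatic index $7$.
   Context: Graphs are simple. A cubic graph is a graph all of whose vertices have degree $3$. A graph is claw-free if it contains no induced $K_{1,3}$. A graph is diamond-free if it contains no $K_4-e$ ($K_4$ minus an edge) as a (not necessarily induced) subgraph; equivalently, no edge lies in two triangles. The triangular prism is $C_3\,\square\,K_2$. A strong edge coloring of a simple graph $G$ assigns colors to the edges of $G$ so that any two distinct edges that are either adjacent (share an endpoint) or joined by an edge of $G$ (some endpoint of one is adjacent in $G$ to some endpoint of the other) receive distinct colors. $G$ is strongly $6$-edge-colorable if it has a strong edge coloring using at most $6$ colors. The strong chromatic index $\chi'_s(G)$ is the minimum number of colors in a strong edge coloring of $G$. The graph $Q$: nine vertices $a_0,a_1,a_2,b_0,b_1,b_2,c_0,c_1,c_2$; its edges are those of the three vertex-disjoint triangles $a_0a_1a_2$, $b_0b_1b_2$, $c_0c_1c_2$ together with the four connecting edges $a_0b_0$, $a_1c_0$, $b_1c_1$, $b_2c_2$ (13 edges in all). The vertex $a_2$ has degree $2$ and all others degree $3$. The graph $H$: take two disjoint copies $Q_1,Q_2$ of $Q$, with corresponding degree-$2$ vertices $a_2^{(1)}$ and $a_2^{(2)}$, and add the single edge $a_2^{(1)}a_2^{(2)}$. It has $18$ vertices and $27$ edges. *)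

theory Defs
  imports Main
begin

record 'a sgraph =
  verts :: "'a set"
  edges :: "'a set set"

definition simple_graph :: "'a sgraph \<Rightarrow> bool" where
  "simple_graph G \<longleftrightarrow>
     (\<forall>e\<in>edges G. \<exists>u\<in>verts G. \<exists>v\<in>verts G. u \<noteq> v \<and> e = {u, v})"

definition degree :: "'a sgraph \<Rightarrow> 'a \<Rightarrow> nat" where
  "degree G v = card {e \<in> edges G. v \<in> e}"

definition cubic :: "'a sgraph \<Rightarrow> bool" where
  "cubic G \<longleftrightarrow> (\<forall>v\<in>verts G. degree G v = 3)"

definition connected_graph :: "'a sgraph \<Rightarrow> bool" where
  "connected_graph G \<longleftrightarrow> verts G \<noteq> {} \<and>
     (\<forall>u\<in>verts G. \<forall>v\<in>verts G. (u, v) \<in> {(x, y). {x, y} \<in> edges G}\<^sup>*)"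

definition isomorphic :: "'a sgraph \<Rightarrow> 'b sgraph \<Rightarrow> bool" where
  "isomorphic G H \<longleftrightarrow> (\<exists>f. bij_betw f (verts G) (verts H) \<and>
     (\<forall>u\<in>verts G. \<forall>v\<in>verts G. {u, v} \<in> edges G \<longleftrightarrow> {f u, f v} \<in> edges H))"

definition subgraph :: "'a sgraph \<Rightarrow> 'a sgraph \<Rightarrow> bool" where
  "subgraph F G \<longleftrightarrow> simple_graph F \<and> verts F \<subseteq> verts G \<and> edges F \<subseteq> edges G"

definition induced_subgraph :: "'a sgraph \<Rightarrow> 'a set \<Rightarrow> 'a sgraph" where
  "induced_subgraph G S = \<lparr>verts = S, edges = {e \<in> edges G. e \<subseteq> S}\<rparr>"

definition complete_graph :: "nat \<Rightarrow> nat sgraph" where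
  "complete_graph n = \<lparr>verts = {..<n}, edges = {{i, j} | i j. i < n \<and> j < n \<and> i \<noteq> j}\<rparr>"

(* Only meaningful as a simple graph for n \<ge> 3. *)
definition cycle_graph :: "nat \<Rightarrow> nat sgraph" where
  "cycle_graph n = \<lparr>verts = {..<n}, edges = {{i, Suc i mod n} | i. i < n}\<rparr>"

definition complete_bipartite :: "nat \<Rightarrow> nat \<Rightarrow> (nat + nat) sgraph" where
  "complete_bipartite m n =
     \<lparr>verts = Inl ` {..<m} \<union> Inr ` {..<n}, edges = {{Inl i, Inr j} | i j. i < m \<and> j < n}\<rparr>"

definition cartesian_product :: "'a sgraph \<Rightarrow> 'b sgraph \<Rightarrow> ('a \<times> 'b) sgraph" where
  "cartesian_product G H =
     \<lparr>verts = verts G \<times> verts H,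
      edges = {{(u, x), (u, y)} | u x y. u \<in> verts G \<and> {x, y} \<in> edges H} \<union>
              {{(u, x), (v, x)} | u v x. {u, v} \<in> edges G \<and> x \<in> verts H}\<rparr>"

definition claw_free :: "'a sgraph \<Rightarrow> bool" where
  "claw_free G \<longleftrightarrow>
     \<not> (\<exists>S \<subseteq> verts G. isomorphic (induced_subgraph G S) (complete_bipartite 1 3))"

definition diamond :: "nat sgraph" where
  "diamond = \<lparr>verts = verts (complete_graph 4), edges = edges (complete_graph 4) - {{0, 1}}\<rparr>"

definition diamond_free :: "'a sgraph \<Rightarrow> bool" where
  "diamond_free G \<longleftrightarrow> \<not> (\<exists>F. subgraph F G \<and> isomorphic F diamond)"

definition prism :: "(nat \<times> nat) sgraph" where
  "prism = cartesian_product (cycle_graph 3) (complete_graph 2)"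

definition strong_edge_coloring :: "'a sgraph \<Rightarrow> ('a set \<Rightarrow> nat) \<Rightarrow> bool" where
  "strong_edge_coloring G c \<longleftrightarrow>
     (\<forall>e\<in>edges G. \<forall>f\<in>edges G.
        e \<noteq> f \<and> (e \<inter> f \<noteq> {} \<or> (\<exists>x\<in>e. \<exists>y\<in>f. {x, y} \<in> edges G)) \<longrightarrow> c e \<noteq> c f)"

definition strongly_edge_colorable :: "nat \<Rightarrow> 'a sgraph \<Rightarrow> bool" where
  "strongly_edge_colorable k G \<longleftrightarrow>
     (\<exists>c. strong_edge_coloring G c \<and> c ` edges G \<subseteq> {..<k})"

(* The minimum exists for every graph with finitely many edges. *)
definition strong_chromatic_index :: "'a sgraph \<Rightarrow> nat" where
  "strong_chromatic_index G = (LEAST k. strongly_edge_colorable k G)"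

datatype qvert = A0 | A1 | A2 | B0 | B1 | B2 | C0 | C1 | C2

definition graph_Q :: "qvert sgraph" where
  "graph_Q =
     \<lparr>verts = {A0, A1, A2, B0, B1, B2, C0, C1, C2},
      edges = {{A0, A1}, {A1, A2}, {A0, A2},
               {B0, B1}, {B1, B2}, {B0, B2},
               {C0, C1}, {C1, C2}, {C0, C2},
               {A0, B0}, {A1, C0}, {B1, C1}, {B2, C2}}\<rparr>"

definition graph_H :: "(qvert + qvert) sgraph" where
  "graph_H =
     \<lparr>verts = Inl ` verts graph_Q \<union> Inr ` verts graph_Q,
      edges = (`) Inl ` edges graph_Q \<union> (`) Inr ` edges graph_Q \<union> {{Inl A2, Inr A2}}\<rparr>"

(* The class of graphs under consideration; graphs are finite. *)
definition admissible :: "'a sgraph \<Rightarrow> bool" where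
  "admissible G \<longleftrightarrow> simple_graph G \<and> finite (verts G) \<and> connected_graph G \<and>
     diamond_free G \<and> claw_free G \<and> cubic G \<and> \<not> isomorphic G prism"

end

theory Submission
  imports Defs
begin

text \<open>
  In a cubic graph that is claw-free and diamond-free, every vertex lies in exactly one triangle:
  claw-freeness puts an edge between two of its three neighbours, and a second such edge would
  complete a diamond.  So the vertices fall into triangles, called blocks below, and each vertex
  has exactly one further neighbour, its mate, in another block; taking mates is a fixed-point-free
  involution.  This local picture is equivalent to the three global conditions
  (\<open>triangular_iff\<close>); the classification of small graphs rests on it and on connectedness.

  The number of vertices is divisible by three because of the blocks and by two because of the
  mates, hence it is 6 or 12 if it is positive and below 18.  With 6 vertices the mates match two
  triangles and the graph is the prism.  With 12 vertices, contracting the four blocks of a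
  connected graph gives a connected loopless cubic multigraph on four vertices.  There are just two:
  if any two blocks are joined by at most one edge, it is \<open>K\<^sub>4\<close>, and otherwise it is
  the 4-cycle with two opposite edges doubled.  (A tripled edge would split off a prism as a
  component.)  Each of these two determines the graph, since a triangle has all permutations of its
  vertices as automorphisms, and for each a strong coloring with six colors is written down.

  For the graph H, the crucial remark is that the six edges meeting a triangle conflict pairwise, so
  that in a strong 6-edge-coloring they use every color once (\<open>triangle_colors\<close>).  In
  Q the triangles on the b's and on the c's are joined by two edges, which
  leaves so little freedom that the edges \<open>b\<^sub>0b\<^sub>1\<close> and \<open>b\<^sub>0b\<^sub>2\<close> repeat
  the colors of \<open>c\<^sub>0c\<^sub>2\<close> and \<open>c\<^sub>0c\<^sub>1\<close>.  These two and the colors of \<open>a\<^sub>0b\<^sub>0\<close>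
  and \<open>a\<^sub>1c\<^sub>0\<close> are four different colors forbidden for all three edges of the triangle on
  the a's, for which only two colors are left
  (\<open>not_strongly_edge_colorable_if_Q\<close>).  A coloring of H with
  seven colors is explicit.
\<close>

section \<open>Claw-free diamond-free cubic graphs as locally triangular graphs\<close>

definition nbrs :: "'a sgraph \<Rightarrow> 'a \<Rightarrow> 'a set" where
  "nbrs G v = {u. {v, u} \<in> edges G}"

text \<open>The local picture at a vertex: two of its three neighbours complete a triangle with it, and the
  third one, \<open>z\<close>, is adjacent to neither of them.\<close>

definition triangular :: "'a sgraph \<Rightarrow> bool" where
  "triangular G \<longleftrightarrow> (\<forall>v\<in>verts G. \<exists>x y z. distinct [x, y, z] \<and> nbrs G v = {x, y, z} \<and>
     {x, y} \<in> edges G \<and> {x, z} \<notin> edges G \<and> {y, z} \<notin> edges G)"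

lemma edge_verts:
  assumes "simple_graph G" "{u, v} \<in> edges G"
  shows "u \<in> verts G" "v \<in> verts G" "u \<noteq> v"
proof -
  obtain a b where "a \<in> verts G" "b \<in> verts G" "a \<noteq> b" "{u, v} = {a, b}"
    using assms unfolding simple_graph_def by blast
  then show "u \<in> verts G" "v \<in> verts G" "u \<noteq> v"
    by (auto simp: doubleton_eq_iff)
qed

lemma mem_nbrs: "u \<in> nbrs G v \<longleftrightarrow> {v, u} \<in> edges G"
  by (simp add: nbrs_def)

lemma degree_eq_card_nbrs:
  assumes "simple_graph G"
  shows "degree G v = card (nbrs G v)"
proof -
  have "{e \<in> edges G. v \<in> e} = (\<lambda>u. {v, u}) ` nbrs G v"
  proof (intro equalityI subsetI)
    fix e assume e: "e \<in> {e \<in> edges G. v \<in> e}"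
    then obtain a b where "e = {a, b}" using assms unfolding simple_graph_def by blast
    then have "e = {v, a} \<or> e = {v, b}" using e by auto
    then show "e \<in> (\<lambda>u. {v, u}) ` nbrs G v" using e by (auto simp: nbrs_def)
  qed (auto simp: nbrs_def)
  moreover have "inj_on (\<lambda>u. {v, u}) (nbrs G v)"
    by (auto simp: inj_on_def doubleton_eq_iff)
  ultimately show ?thesis unfolding degree_def by (simp add: card_image)
qed

lemma isomorphic_sym:
  assumes "isomorphic G H"
  shows "isomorphic H G"
proof -
  obtain f where f: "bij_betw f (verts G) (verts H)"
    and e: "\<forall>u\<in>verts G. \<forall>v\<in>verts G. {u, v} \<in> edges G \<longleftrightarrow> {f u, f v} \<in> edges H"
    using assms unfolding isomorphic_def by blast
  let ?g = "inv_into (verts G) f"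
  have "bij_betw ?g (verts H) (verts G)" using f by (rule bij_betw_inv_into)
  moreover have "{x, y} \<in> edges H \<longleftrightarrow> {?g x, ?g y} \<in> edges G"
    if "x \<in> verts H" "y \<in> verts H" for x y
  proof -
    have "?g x \<in> verts G" "?g y \<in> verts G" "f (?g x) = x" "f (?g y) = y"
      using that f by (auto simp: bij_betw_def inv_into_into f_inv_into_f)
    then show ?thesis using e by metis
  qed
  ultimately show ?thesis unfolding isomorphic_def by blast
qed

text \<open>Comparing edge sets through the image map avoids a case distinction on pairs of vertices; the
  injectivity of \<open>f\<close> on vertices carries over to sets of vertices.\<close>

lemma isomorphicI:
  assumes "simple_graph G" "bij_betw f (verts G) (verts H)" "edges H = (`) f ` edges G"
  shows "isomorphic G H"
proof -
  have inj: "inj_on ((`) f) (Pow (verts G))"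
    using assms(2) by (simp add: bij_betw_def inj_on_image_Pow)
  have "edges G \<subseteq> Pow (verts G)" using assms(1) by (auto simp: simple_graph_def)
  then have "f ` e \<in> edges H \<longleftrightarrow> e \<in> edges G" if "e \<subseteq> verts G" for e
    unfolding assms(3) using inj_on_image_mem_iff[OF inj] that by auto
  from this[of "{_, _}"] show ?thesis using assms(2) unfolding isomorphic_def by auto
qed

lemma claw_edges: "edges (complete_bipartite 1 3) = {{Inl 0, Inr 0}, {Inl 0, Inr 1}, {Inl 0, Inr 2}}"
proof -
  have "j < 3 \<longleftrightarrow> j = 0 \<or> j = 1 \<or> j = 2" for j :: nat by auto
  then show ?thesis by (auto simp: complete_bipartite_def)
qed

lemma claw_verts: "verts (complete_bipartite 1 3) = {Inl 0, Inr 0, Inr 1, Inr 2}"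
  by (auto simp: complete_bipartite_def)

lemma claw_free_iff:
  assumes G: "simple_graph G"
  shows "claw_free G \<longleftrightarrow> (\<forall>v x y z. distinct [x, y, z] \<and> {x, y, z} \<subseteq> nbrs G v \<longrightarrow>
           {x, y} \<in> edges G \<or> {x, z} \<in> edges G \<or> {y, z} \<in> edges G)"
proof (intro iffI allI impI)
  fix v x y z assume cf: "claw_free G" and d: "distinct [x, y, z] \<and> {x, y, z} \<subseteq> nbrs G v"
  then have n: "{v, x} \<in> edges G" "{v, y} \<in> edges G" "{v, z} \<in> edges G" by (auto simp: nbrs_def)
  have V: "{v, x, y, z} \<subseteq> verts G" and ne: "v \<noteq> x" "v \<noteq> y" "v \<noteq> z"
    using n[THEN edge_verts(1)[OF G]] n[THEN edge_verts(2)[OF G]] n[THEN edge_verts(3)[OF G]] by simp_all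
  show "{x, y} \<in> edges G \<or> {x, z} \<in> edges G \<or> {y, z} \<in> edges G"
  proof (rule ccontr)
    assume non: "\<not> ?thesis"
    define f :: "'a \<Rightarrow> nat + nat" where
      "f u = (if u = v then Inl 0 else if u = x then Inr 0 else if u = y then Inr 1 else Inr 2)" for u
    have f: "f v = Inl 0" "f x = Inr 0" "f y = Inr 1" "f z = Inr 2"
      using d ne by (auto simp: f_def)
    let ?S = "{v, x, y, z}"
    have sub: "simple_graph (induced_subgraph G ?S)"
      unfolding simple_graph_def
    proof
      fix e assume e: "e \<in> edges (induced_subgraph G ?S)"
      then obtain p q where "p \<noteq> q" "e = {p, q}"
        using G unfolding simple_graph_def induced_subgraph_def by force
      then show "\<exists>p\<in>verts (induced_subgraph G ?S). \<exists>q\<in>verts (induced_subgraph G ?S). p \<noteq> q \<and> e = {p, q}"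
        using e by (intro bexI[of _ p] bexI[of _ q]) (simp_all add: induced_subgraph_def)
    qed
    have "edges (induced_subgraph G ?S) = {{v, x}, {v, y}, {v, z}}"
    proof (intro equalityI subsetI)
      fix e assume e: "e \<in> edges (induced_subgraph G ?S)"
      then obtain p q where "e = {p, q}" "p \<in> ?S" "q \<in> ?S" "p \<noteq> q"
        using sub unfolding simple_graph_def by (metis induced_subgraph_def select_convs(1))
      moreover have "e \<in> edges G" using e by (simp add: induced_subgraph_def)
      ultimately show "e \<in> {{v, x}, {v, y}, {v, z}}" using non
        by (elim insertE emptyE) (simp_all add: insert_commute)
    qed (use n in \<open>auto simp: induced_subgraph_def\<close>)
    then have "edges (complete_bipartite 1 3) = (`) f ` edges (induced_subgraph G ?S)"
      unfolding claw_edges by (simp add: f)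
    moreover have "bij_betw f (verts (induced_subgraph G ?S)) (verts (complete_bipartite 1 3))"
      unfolding bij_betw_def inj_on_def claw_verts
      using f d ne by (auto simp: induced_subgraph_def)
    ultimately have "isomorphic (induced_subgraph G ?S) (complete_bipartite 1 3)"
      using isomorphicI[OF sub] by blast
    with cf V show False unfolding claw_free_def by blast
  qed
next
  assume local: "\<forall>v x y z. distinct [x, y, z] \<and> {x, y, z} \<subseteq> nbrs G v \<longrightarrow>
           {x, y} \<in> edges G \<or> {x, z} \<in> edges G \<or> {y, z} \<in> edges G"
  show "claw_free G" unfolding claw_free_def
  proof
    assume "\<exists>S\<subseteq>verts G. isomorphic (induced_subgraph G S) (complete_bipartite 1 3)"
    then obtain S where "isomorphic (complete_bipartite 1 3) (induced_subgraph G S)"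
      using isomorphic_sym by blast
    then obtain g where "bij_betw g (verts (complete_bipartite 1 3)) (verts (induced_subgraph G S))"
      and e: "\<forall>p\<in>verts (complete_bipartite 1 3). \<forall>q\<in>verts (complete_bipartite 1 3).
        {p, q} \<in> edges (complete_bipartite 1 3) \<longleftrightarrow> {g p, g q} \<in> edges (induced_subgraph G S)"
      unfolding isomorphic_def by blast
    then have g: "bij_betw g {Inl 0, Inr 0, Inr 1, Inr 2} S"
      unfolding claw_verts by (simp add: induced_subgraph_def)
    have S: "g p \<in> S" if "p \<in> {Inl 0, Inr 0, Inr 1, Inr 2}" for p
      using g that by (rule bij_betw_apply)
    have e': "{p, q} \<in> edges (complete_bipartite 1 3) \<longleftrightarrow> {g p, g q} \<in> edges G"
      if "p \<in> {Inl 0, Inr 0, Inr 1, Inr 2}" "q \<in> {Inl 0, Inr 0, Inr 1, Inr 2}" for p q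
      using e[unfolded claw_verts, rule_format, OF that] S[OF that(1)] S[OF that(2)]
      by (simp add: induced_subgraph_def)
    have "distinct [g (Inr 0), g (Inr 1), g (Inr 2)]"
      using g unfolding bij_betw_def inj_on_def by auto
    moreover have "{g (Inr 0), g (Inr 1), g (Inr 2)} \<subseteq> nbrs G (g (Inl 0))"
      using e'[unfolded claw_edges, of "Inl 0" "Inr 0"] e'[unfolded claw_edges, of "Inl 0" "Inr 1"]
        e'[unfolded claw_edges, of "Inl 0" "Inr 2"] by (simp add: mem_nbrs)
    ultimately have "{g (Inr 0), g (Inr 1)} \<in> edges G \<or> {g (Inr 0), g (Inr 2)} \<in> edges G \<or>
        {g (Inr 1), g (Inr 2)} \<in> edges G" using local by blast
    then show False using e'[unfolded claw_edges, of "Inr 0" "Inr 1"]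
        e'[unfolded claw_edges, of "Inr 0" "Inr 2"] e'[unfolded claw_edges, of "Inr 1" "Inr 2"]
      by (simp add: doubleton_eq_iff)
  qed
qed

lemma diamond_verts: "verts diamond = {0, 1, 2, 3}"
  by (auto simp: diamond_def complete_graph_def)

lemma diamond_edges: "edges diamond = {{2, 3}, {2, 0}, {2, 1}, {3, 0}, {3, 1}}"
proof -
  have less: "j < 4 \<longleftrightarrow> j = 0 \<or> j = 1 \<or> j = 2 \<or> j = 3" for j :: nat by auto
  have K4: "edges (complete_graph 4) = {{0, 1}, {2, 3}, {2, 0}, {2, 1}, {3, 0}, {3, 1}}"
    (is "?L = ?R")
  proof (intro equalityI subsetI)
    fix e assume "e \<in> ?L"
    then obtain i j where "e = {i, j}" "i < 4" "j < 4" "i \<noteq> j"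
      by (auto simp: complete_graph_def)
    then show "e \<in> ?R" unfolding less by (elim disjE) (simp_all add: insert_commute)
  next
    fix e assume "e \<in> ?R"
    then have "\<exists>i j. i < 4 \<and> j < 4 \<and> i \<noteq> j \<and> e = {i, j}"
      by (elim insertE emptyE) (intro exI conjI, assumption?, auto)+
    then show "e \<in> ?L" by (auto simp: complete_graph_def)
  qed
  show ?thesis unfolding diamond_def by (simp add: K4 doubleton_eq_iff insert_Diff_if)
qed

lemma diamond_free_iff:
  assumes G: "simple_graph G"
  shows "diamond_free G \<longleftrightarrow> (\<forall>u v x y. x \<noteq> y \<and> {u, v} \<in> edges G \<longrightarrow>
           \<not> {x, y} \<subseteq> nbrs G u \<inter> nbrs G v)"
proof (intro iffI allI impI notI)
  fix u v x y assume df: "diamond_free G" and xy: "x \<noteq> y \<and> {u, v} \<in> edges G"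
    and c: "{x, y} \<subseteq> nbrs G u \<inter> nbrs G v"
  let ?E = "{{u, v}, {u, x}, {u, y}, {v, x}, {v, y}}"
  let ?F = "\<lparr>verts = {x, y, u, v}, edges = ?E\<rparr>"
  have e: "{u, v} \<in> edges G" "{u, x} \<in> edges G" "{u, y} \<in> edges G" "{v, x} \<in> edges G" "{v, y} \<in> edges G"
    using xy c by (auto simp: nbrs_def)
  then have E: "?E \<subseteq> edges G" by simp
  have V: "{x, y, u, v} \<subseteq> verts G" and ne: "u \<noteq> v" "u \<noteq> x" "u \<noteq> y" "v \<noteq> x" "v \<noteq> y"
    using e[THEN edge_verts(1)[OF G]] e[THEN edge_verts(2)[OF G]] e[THEN edge_verts(3)[OF G]] by simp_all
  have "subgraph ?F G" unfolding subgraph_def simple_graph_def using E V ne by auto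
  moreover have "isomorphic ?F diamond"
  proof -
    define f :: "'a \<Rightarrow> nat" where
      "f w = (if w = x then 0 else if w = y then 1 else if w = u then 2 else 3)" for w
    have f: "f x = 0" "f y = 1" "f u = 2" "f v = 3" using ne xy by (auto simp: f_def)
    have "bij_betw f {x, y, u, v} {0, 1, 2, 3}"
      unfolding bij_betw_def inj_on_def using f ne xy by auto
    moreover have "edges diamond = (`) f ` ?E" by (simp add: diamond_edges f)
    ultimately show ?thesis
      using isomorphicI[of ?F f diamond] \<open>subgraph ?F G\<close>
      unfolding diamond_verts subgraph_def by simp
  qed
  ultimately show False using df unfolding diamond_free_def by blast
next
  assume local: "\<forall>u v x y. x \<noteq> y \<and> {u, v} \<in> edges G \<longrightarrow> \<not> {x, y} \<subseteq> nbrs G u \<inter> nbrs G v"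
  show "diamond_free G" unfolding diamond_free_def
  proof
    assume "\<exists>F. subgraph F G \<and> isomorphic F diamond"
    then obtain F where F: "subgraph F G" and "isomorphic diamond F"
      using isomorphic_sym by blast
    then obtain g where "bij_betw g (verts diamond) (verts F)"
      and e: "\<forall>i\<in>verts diamond. \<forall>j\<in>verts diamond.
        {i, j} \<in> edges diamond \<longleftrightarrow> {g i, g j} \<in> edges F"
      unfolding isomorphic_def by blast
    then have g: "bij_betw g {0, 1, 2, 3} (verts F)" by (simp add: diamond_verts)
    have e: "{g i, g j} \<in> edges G"
      if "i \<in> {0, 1, 2, 3}" "j \<in> {0, 1, 2, 3}" "{i, j} \<in> edges diamond" for i j
      using e[unfolded diamond_verts, rule_format, OF that(1,2)] that(3) F
      unfolding subgraph_def by blast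
    have "g 0 \<noteq> g 1" using g unfolding bij_betw_def inj_on_def by auto
    moreover have "{g 2, g 3} \<in> edges G" by (rule e) (simp_all add: diamond_edges)
    moreover have "{g 0, g 1} \<subseteq> nbrs G (g 2) \<inter> nbrs G (g 3)"
      using e[of 2 0] e[of 2 1] e[of 3 0] e[of 3 1] by (simp add: mem_nbrs diamond_edges)
    ultimately show False using local by blast
  qed
qed

text \<open>A claw-free vertex of degree three has an edge among its neighbours, and two such edges share one
  of these neighbours, which together with the vertex forms the middle edge of a diamond.\<close>

lemma triangular_iff:
  assumes G: "simple_graph G"
  shows "triangular G \<longleftrightarrow> cubic G \<and> claw_free G \<and> diamond_free G"
proof
  assume T: "triangular G"
  have vert: "v \<in> verts G" if "w \<in> nbrs G v" for v w
    using that edge_verts(1)[OF G, of v w] by (simp add: mem_nbrs)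
  have "cubic G" using T unfolding cubic_def triangular_def degree_eq_card_nbrs[OF G] by force
  moreover have "claw_free G" unfolding claw_free_iff[OF G]
  proof (intro allI impI)
    fix v x y z assume d: "distinct [x, y, z] \<and> {x, y, z} \<subseteq> nbrs G v"
    then obtain a b c where abc: "nbrs G v = {a, b, c}" "{a, b} \<in> edges G"
      using T vert unfolding triangular_def by (metis insert_subset)
    have "card {x, y, z} = 3" "card {a, b, c} \<le> 3" using d by (auto simp: card_insert_if)
    then have "{x, y, z} = {a, b, c}" using d abc(1) by (intro card_seteq) auto
    then have "a \<in> {x, y, z}" "b \<in> {x, y, z}" by auto
    then show "{x, y} \<in> edges G \<or> {x, z} \<in> edges G \<or> {y, z} \<in> edges G"
      using abc(2) edge_verts(3)[OF G abc(2)]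
      by (elim insertE emptyE) (simp_all add: insert_commute)
  qed
  moreover have "diamond_free G" unfolding diamond_free_iff[OF G]
  proof (intro allI impI notI)
    fix u v x y assume xy: "x \<noteq> y \<and> {u, v} \<in> edges G" and c: "{x, y} \<subseteq> nbrs G u \<inter> nbrs G v"
    then obtain a b c where abc: "nbrs G u = {a, b, c}" "{a, c} \<notin> edges G" "{b, c} \<notin> edges G"
      using T vert unfolding triangular_def by (metis insert_subset le_inf_iff)
    have "{x, y, v} \<subseteq> nbrs G u" "{v, x} \<in> edges G" "{v, y} \<in> edges G"
      using xy c by (auto simp: mem_nbrs)
    moreover have "v \<noteq> x" "v \<noteq> y" using calculation(2,3)[THEN edge_verts(3)[OF G]] by simp_all
    ultimately show False using abc xy by (auto simp: insert_commute)
  qed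
  ultimately show "cubic G \<and> claw_free G \<and> diamond_free G" by blast
next
  assume A: "cubic G \<and> claw_free G \<and> diamond_free G"
  have df: "\<not> (x \<noteq> y \<and> {u, v} \<in> edges G \<and> {x, y} \<subseteq> nbrs G u \<inter> nbrs G v)" for u v x y
    using A diamond_free_iff[OF G] by blast
  show "triangular G" unfolding triangular_def
  proof
    fix v assume "v \<in> verts G"
    then have "card (nbrs G v) = 3" using A degree_eq_card_nbrs[OF G] by (simp add: cubic_def)
    then obtain a b c where abc: "nbrs G v = {a, b, c}" "distinct [a, b, c]"
      unfolding card_3_iff by auto
    then have "{a, b} \<in> edges G \<or> {a, c} \<in> edges G \<or> {b, c} \<in> edges G"
      using A claw_free_iff[OF G] by (metis order_refl)
    then obtain x y z where n: "nbrs G v = {x, y, z}" "distinct [x, y, z]" "{x, y} \<in> edges G"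
    proof (elim disjE)
      assume "{a, b} \<in> edges G" then show thesis using that[of a b c] abc by auto
    next
      assume "{a, c} \<in> edges G" then show thesis using that[of a c b] abc by auto
    next
      assume "{b, c} \<in> edges G" then show thesis using that[of b c a] abc by auto
    qed
    have e: "{v, x} \<in> edges G" "{v, y} \<in> edges G" "{v, z} \<in> edges G"
      using n(1) by (auto simp: nbrs_def)
    have "{x, z} \<notin> edges G" using df[of y z v x] n e by (auto simp: nbrs_def insert_commute)
    moreover have "{y, z} \<notin> edges G" using df[of x z v y] n e by (auto simp: nbrs_def insert_commute)
    ultimately show "\<exists>x y z. distinct [x, y, z] \<and> nbrs G v = {x, y, z} \<and>
        {x, y} \<in> edges G \<and> {x, z} \<notin> edges G \<and> {y, z} \<notin> edges G" using n by blast
  qed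
qed

section \<open>Triangles and the edges between them\<close>

text \<open>In a locally triangular graph, having a common neighbour with \<open>v\<close> singles out, among the neighbours of \<open>v\<close>, the two
  that lie in its triangle.  The neighbour left over is the mate.\<close>

definition block :: "'a sgraph \<Rightarrow> 'a \<Rightarrow> 'a set" where
  "block G v = insert v {u \<in> nbrs G v. nbrs G u \<inter> nbrs G v \<noteq> {}}"

definition mate :: "'a sgraph \<Rightarrow> 'a \<Rightarrow> 'a" where
  "mate G v = (THE u. u \<in> nbrs G v \<and> nbrs G u \<inter> nbrs G v = {})"

locale triangular_graph =
  fixes G :: "'a sgraph"
  assumes simple: "simple_graph G" and triangular: "triangular G"
begin

lemma block_structure:
  assumes "v \<in> verts G"
  obtains x y where "distinct [v, x, y, mate G v]" "block G v = {v, x, y}"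
    "nbrs G v = {x, y, mate G v}" "{x, y} \<in> edges G" "nbrs G (mate G v) \<inter> nbrs G v = {}"
proof -
  obtain x y z where d: "distinct [x, y, z]" and n: "nbrs G v = {x, y, z}"
    and e: "{x, y} \<in> edges G" "{x, z} \<notin> edges G" "{y, z} \<notin> edges G"
    using assms triangular unfolding triangular_def by blast
  have loop: "w \<notin> nbrs G w" for w
    using edge_verts(3)[OF simple, of w w] by (auto simp: nbrs_def)
  have v: "v \<notin> {x, y, z}" using loop[of v] n by simp
  have x: "y \<in> nbrs G x" "x \<in> nbrs G y" using e by (auto simp: nbrs_def insert_commute)
  have z: "nbrs G z \<inter> nbrs G v = {}"
    using e(2,3) loop[of z] unfolding n by (auto simp: nbrs_def insert_commute)
  have "mate G v = z" unfolding mate_def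
  proof (rule the_equality)
    show "z \<in> nbrs G v \<and> nbrs G z \<inter> nbrs G v = {}" using n z by simp
    fix u assume "u \<in> nbrs G v \<and> nbrs G u \<inter> nbrs G v = {}"
    then show "u = z" using n x by auto
  qed
  moreover have "block G v = {v, x, y}"
    using x z unfolding block_def n by auto
  ultimately show thesis using that[of x y] d n e v z by auto
qed

lemma mem_block_self [simp]: "v \<in> block G v"
  by (simp add: block_def)

lemma nbrs_eq:
  assumes "v \<in> verts G"
  shows "nbrs G v = insert (mate G v) (block G v - {v})"
proof -
  obtain x y where "distinct [v, x, y, mate G v]" "block G v = {v, x, y}"
    "nbrs G v = {x, y, mate G v}" by (rule block_structure[OF assms])
  then show ?thesis by auto
qed

lemma card_block: "v \<in> verts G \<Longrightarrow> card (block G v) = 3"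
  by (rule block_structure) auto

lemma finite_block: "v \<in> verts G \<Longrightarrow> finite (block G v)"
  by (rule block_structure) auto

lemma mate_notin_block: "v \<in> verts G \<Longrightarrow> mate G v \<notin> block G v"
  by (rule block_structure) auto

lemma block_subset: "v \<in> verts G \<Longrightarrow> block G v \<subseteq> verts G"
  using edge_verts(2)[OF simple] by (auto simp: block_def nbrs_def)

text \<open>A block is a triangle, so each of its vertices sees the other two as neighbours with a common
  neighbour; the inclusion of blocks obtained in this way is an equality because all blocks have
  three elements.\<close>

lemma block_cong:
  assumes "v \<in> verts G" "u \<in> block G v"
  shows "block G u = block G v"
proof -
  obtain x y where b: "block G v = {v, x, y}" "nbrs G v = {x, y, mate G v}" "{x, y} \<in> edges G"
    by (rule block_structure[OF assms(1)])
  have e: "{v, x} \<in> edges G" "{v, y} \<in> edges G" using b(2) by (auto simp: nbrs_def)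
  have tri: "{p, q, r} \<subseteq> block G p"
    if "{p, q} \<in> edges G" "{p, r} \<in> edges G" "{q, r} \<in> edges G" for p q r
    using that by (auto simp: block_def nbrs_def insert_commute)
  have "block G v \<subseteq> block G u"
  proof (cases "u = v")
    case False
    then have "u = x \<or> u = y" using assms(2) b(1) by auto
    then show ?thesis
      using tri[of x v y] tri[of y v x] b(3) e unfolding b(1) by (auto simp: insert_commute)
  qed simp
  moreover have "u \<in> verts G" using block_subset assms by blast
  ultimately show ?thesis
    using card_block[OF assms(1)] card_block[of u] finite_block[of u]
    by (metis card_subset_eq)
qed

lemma blocks_disjoint:
  assumes "u \<in> verts G" "v \<in> verts G" "block G u \<noteq> block G v"
  shows "block G u \<inter> block G v = {}"
  using block_cong assms by blast

lemma block_eqI: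
  assumes "v \<in> verts G" "distinct [a, b, c]" "{a, b, c} \<subseteq> block G v"
  shows "block G v = {a, b, c}"
  using card_subset_eq[OF finite_block[OF assms(1)] assms(3)] card_block[OF assms(1)] assms(2) by simp

lemma mate_in_nbrs: "v \<in> verts G \<Longrightarrow> mate G v \<in> nbrs G v"
  by (simp add: nbrs_eq)

lemma mate_in_verts: "v \<in> verts G \<Longrightarrow> mate G v \<in> verts G"
  using mate_in_nbrs edge_verts(2)[OF simple] by (auto simp: nbrs_def)

text \<open>The edge to the mate leaves the block of \<open>v\<close> and hence also that of the mate, where only
  one edge leaves at each vertex.\<close>

lemma mate_mate:
  assumes "v \<in> verts G"
  shows "mate G (mate G v) = v"
proof -
  have "v \<in> nbrs G (mate G v)"
    using mate_in_nbrs[OF assms] by (simp add: nbrs_def insert_commute)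
  moreover have "v \<notin> block G (mate G v)"
    using block_cong[OF mate_in_verts[OF assms]] mate_notin_block[OF assms] mem_block_self by metis
  ultimately show ?thesis using nbrs_eq[OF mate_in_verts[OF assms]] by auto
qed

lemma mate_eq_iff: "u \<in> verts G \<Longrightarrow> v \<in> verts G \<Longrightarrow> mate G u = mate G v \<longleftrightarrow> u = v"
  using mate_mate by metis

lemma edgeE:
  assumes "e \<in> edges G"
  obtains (within) u v where "u \<in> verts G" "v \<in> block G u" "u \<noteq> v" "e = {u, v}"
  | (between) u where "u \<in> verts G" "e = {u, mate G u}"
proof -
  obtain u v where uv: "u \<in> verts G" "e = {u, v}"
    using assms simple unfolding simple_graph_def by blast
  then have "v \<in> nbrs G u" using assms by (simp add: nbrs_def)
  then show thesis using that uv nbrs_eq[OF uv(1)] by auto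
qed

lemma edge_within: "u \<in> verts G \<Longrightarrow> v \<in> block G u \<Longrightarrow> u \<noteq> v \<Longrightarrow> {u, v} \<in> edges G"
  using nbrs_eq[of u] by (auto simp: nbrs_def)

lemma edge_between: "u \<in> verts G \<Longrightarrow> {u, mate G u} \<in> edges G"
  using mate_in_nbrs by (simp add: nbrs_def)

lemma Union_blocks: "\<Union> (block G ` verts G) = verts G"
  using block_subset mem_block_self by blast

lemma card_blocks:
  assumes "finite (verts G)"
  shows "3 * card (block G ` verts G) = card (verts G)"
proof -
  have "3 * card (block G ` verts G) = card (\<Union> (block G ` verts G))"
    using assms card_block blocks_disjoint
    by (intro card_partition) (auto simp: Union_blocks)
  then show ?thesis by (simp add: Union_blocks)
qed

text \<open>The pairs consisting of a vertex and its mate partition the vertices.\<close>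

lemma even_card_verts:
  assumes "finite (verts G)"
  shows "even (card (verts G))"
proof -
  let ?P = "(\<lambda>v. {v, mate G v}) ` verts G"
  have U: "\<Union> ?P = verts G" using mate_in_verts by auto
  have "2 dvd card (\<Union> ?P)"
  proof (rule dvd_partition)
    show "finite (\<Union> ?P)" using assms U by simp
    show "\<forall>c\<in>?P. 2 dvd card c"
    proof
      fix c assume "c \<in> ?P"
      then obtain v where v: "v \<in> verts G" "c = {v, mate G v}" by blast
      then have "v \<noteq> mate G v" using mate_notin_block by (metis mem_block_self)
      then show "2 dvd card c" using v by simp
    qed
    have "c = {w, mate G w}" if "c \<in> ?P" "w \<in> c" for c w
      using that mate_mate by auto
    then show "\<forall>c1\<in>?P. \<forall>c2\<in>?P. c1 \<noteq> c2 \<longrightarrow> c1 \<inter> c2 = {}"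
      by (metis disjoint_iff)
  qed
  then show ?thesis using U by simp
qed

lemma six_dvd_card_verts:
  assumes "finite (verts G)"
  shows "6 dvd card (verts G)"
  using even_card_verts[OF assms] card_blocks[OF assms] by presburger

end

section \<open>Six vertices: the prism\<close>

lemma cartesian_product_edge_iff:
  "e \<in> edges (cartesian_product G H) \<longleftrightarrow>
     (\<exists>u x y. e = {(u, x), (u, y)} \<and> u \<in> verts G \<and> {x, y} \<in> edges H) \<or>
     (\<exists>u v x. e = {(u, x), (v, x)} \<and> {u, v} \<in> edges G \<and> x \<in> verts H)"
  by (simp only: cartesian_product_def select_convs Un_iff mem_Collect_eq)

lemma cycle_graph_3:
  "verts (cycle_graph 3) = {0, 1, 2}" "edges (cycle_graph 3) = {{0, 1}, {1, 2}, {2, 0}}"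
proof -
  have less: "i < 3 \<longleftrightarrow> i = 0 \<or> i = 1 \<or> i = 2" for i :: nat by auto
  show "verts (cycle_graph 3) = {0, 1, 2}" by (auto simp: cycle_graph_def)
  have "edges (cycle_graph 3) = (\<lambda>i. {i, Suc i mod 3}) ` {0, 1, 2}"
    by (auto simp: cycle_graph_def less)
  then show "edges (cycle_graph 3) = {{0, 1}, {1, 2}, {2, 0}}"
    by (simp add: numeral_2_eq_2)
qed

lemma complete_graph_2: "verts (complete_graph 2) = {0, 1}" "edges (complete_graph 2) = {{0, 1}}"
proof -
  show "verts (complete_graph 2) = {0, 1}" by (auto simp: complete_graph_def)
  have "e \<in> {{0, 1}}" if e: "e \<in> {{i, j} |i j. i < 2 \<and> j < 2 \<and> i \<noteq> j}" for e :: "nat set"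
  proof -
    obtain i j where "e = {i, j}" "i < 2" "j < 2" "i \<noteq> j" using e by blast
    then show ?thesis by (auto simp: less_2_cases_iff)
  qed
  then show "edges (complete_graph 2) = {{0, 1}}"
    unfolding complete_graph_def select_convs
  proof (intro equalityI subsetI)
    show "e \<in> {{i, j} |i j. i < 2 \<and> j < 2 \<and> i \<noteq> j}" if "e \<in> {{0, 1}}" for e :: "nat set"
      using that by (intro CollectI exI[of _ 0] exI[of _ 1]) simp
  qed
qed

lemma prism_verts:
  "verts prism = {(0, 0), (1, 0), (2, 0), (0, 1), (1, 1), (2, 1)}"
proof -
  have "verts prism = {0, 1, 2} \<times> {0, 1}"
    by (simp only: prism_def cartesian_product_def select_convs cycle_graph_3 complete_graph_2)
  then show ?thesis by auto
qed

lemma prism_edges: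
  "edges prism = {{(0, 0), (1, 0)}, {(1, 0), (2, 0)}, {(2, 0), (0, 0)},
     {(0, 1), (1, 1)}, {(1, 1), (2, 1)}, {(2, 1), (0, 1)},
     {(0, 0), (0, 1)}, {(1, 0), (1, 1)}, {(2, 0), (2, 1)}}" (is "_ = ?R")
proof (intro equalityI subsetI)
  fix e assume "e \<in> edges prism"
  then show "e \<in> ?R"
    unfolding prism_def cartesian_product_edge_iff cycle_graph_3 complete_graph_2
  proof (elim disjE exE conjE)
    fix u x y :: nat
    assume e: "e = {(u, x), (u, y)}" and u: "u \<in> {0, 1, 2}" and xy: "{x, y} \<in> {{0, 1}}"
    from e have "e = Pair u ` {x, y}" by simp
    then have "e = Pair u ` {0, 1}" unfolding singletonD[OF xy] .
    with u show ?thesis by (elim insertE emptyE) simp_all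
  next
    fix u v x :: nat
    assume e: "e = {(u, x), (v, x)}" and uv: "{u, v} \<in> {{0, 1}, {1, 2}, {2, 0}}" and x: "x \<in> {0, 1}"
    from e have "e = (\<lambda>w. (w, x)) ` {u, v}" by simp
    then obtain W where "e = (\<lambda>w. (w, x)) ` W" "W \<in> {{0, 1}, {1, 2}, {2, 0}}" using uv by iprover
    with x show ?thesis by (elim insertE emptyE) simp_all
  qed
next
  have *: "{(u, 0), (u, 1)} \<in> edges prism" if "u \<in> {0, 1, 2}" for u
    using that unfolding prism_def cartesian_product_edge_iff cycle_graph_3 complete_graph_2
    by (intro disjI1 exI[of _ u] exI[of _ 0] exI[of _ 1]) simp
  have **: "{(u, x), (v, x)} \<in> edges prism"
    if "{u, v} \<in> {{0, 1}, {1, 2}, {2, 0}}" "x \<in> {0, 1}" for u v x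
    using that unfolding prism_def cartesian_product_edge_iff cycle_graph_3 complete_graph_2
    by (intro disjI2 exI[of _ u] exI[of _ v] exI[of _ x] conjI refl)
  show "e \<in> edges prism" if "e \<in> ?R" for e
    using that by (elim insertE emptyE) (simp_all add: *[unfolded One_nat_def] **)
qed

text \<open>The mates of the vertices of one block are the three remaining vertices, which therefore form the
  other block.\<close>

lemma (in triangular_graph) isomorphic_prism:
  assumes "card (verts G) = 6"
  shows "isomorphic G prism"
proof -
  have fin: "finite (verts G)" using assms card.infinite by fastforce
  then obtain v where v: "v \<in> verts G" using assms by fastforce
  obtain a b c where abc: "block G v = {a, b, c}" "distinct [a, b, c]"
    using card_block[OF v] unfolding card_3_iff by auto
  have V: "a \<in> verts G" "b \<in> verts G" "c \<in> verts G" using block_subset[OF v] abc by auto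
  have bl: "block G a = {a, b, c}" "block G b = {a, b, c}" "block G c = {a, b, c}"
    using block_cong[OF v] abc by auto
  let ?m = "mate G"
  have mm: "?m (?m a) = a" "?m (?m b) = b" "?m (?m c) = c" using V mate_mate by auto
  have d: "distinct [a, b, c, ?m a, ?m b, ?m c]"
    using V[THEN mate_notin_block] abc(2) by (simp add: bl mate_eq_iff V) metis
  have mV: "?m a \<in> verts G" "?m b \<in> verts G" "?m c \<in> verts G" using V mate_in_verts by auto
  have VG: "verts G = {a, b, c, ?m a, ?m b, ?m c}"
    using card_subset_eq[OF fin, of "set [a, b, c, ?m a, ?m b, ?m c]"] assms V mV
      distinct_card[OF d] by simp
  have other: "block G w = {?m a, ?m b, ?m c}" if "w \<in> {?m a, ?m b, ?m c}" for w
  proof -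
    have w: "w \<in> verts G" "w \<notin> {a, b, c}" using that mV d by auto
    have "block G w \<inter> block G a = {}"
      using blocks_disjoint[OF w(1) V(1)] bl(1) w(2) mem_block_self[of w] by metis
    then have "block G w \<subseteq> {?m a, ?m b, ?m c}"
      using block_subset[OF w(1)] bl(1) VG by auto
    then show ?thesis using card_block[OF w(1)] d by (intro card_subset_eq) auto
  qed
  have other': "block G (?m a) = {?m a, ?m b, ?m c}" "block G (?m b) = {?m a, ?m b, ?m c}"
    "block G (?m c) = {?m a, ?m b, ?m c}"
    by (rule other; simp)+
  define g :: "nat \<times> nat \<Rightarrow> 'a" where
    "g = (\<lambda>(i, j). (if j = 0 then id else ?m) (if i = 0 then a else if i = 1 then b else c))"
  have g: "g (0, 0) = a" "g (1, 0) = b" "g (2, 0) = c"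
    "g (0, 1) = ?m a" "g (1, 1) = ?m b" "g (2, 1) = ?m c"
    by (simp_all add: g_def)
  let ?E = "{{a, b}, {b, c}, {c, a}, {?m a, ?m b}, {?m b, ?m c}, {?m c, ?m a},
    {a, ?m a}, {b, ?m b}, {c, ?m c}}"
  have "edges G = ?E"
  proof (intro equalityI subsetI)
    fix e assume "e \<in> edges G"
    then show "e \<in> ?E"
    proof (cases rule: edgeE)
      case (within u v)
      show ?thesis
      proof (cases "u \<in> {a, b, c}")
        case True
        then have "v \<in> {a, b, c}" using within bl by auto
        with True within(3,4) show ?thesis by (elim insertE emptyE) (simp_all add: insert_commute)
      next
        case False
        then have u: "u \<in> {?m a, ?m b, ?m c}" using within(1) VG by blast
        then have "v \<in> {?m a, ?m b, ?m c}" using within(2) other by blast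
        with u within(3,4) show ?thesis by (elim insertE emptyE) (simp_all add: insert_commute)
      qed
    next
      case (between u)
      then show ?thesis unfolding VG
        by (elim insertE emptyE) (simp_all add: mm insert_commute)
    qed
  next
    have "{a, b} \<in> edges G" "{b, c} \<in> edges G" "{c, a} \<in> edges G"
      using V bl abc(2) by (auto intro: edge_within)
    moreover have "{?m a, ?m b} \<in> edges G" "{?m b, ?m c} \<in> edges G" "{?m c, ?m a} \<in> edges G"
      using edge_within[OF mV(1), of "?m b"] edge_within[OF mV(2), of "?m c"]
        edge_within[OF mV(1), of "?m c"] d by (simp_all add: other' insert_commute)
    moreover have "{a, ?m a} \<in> edges G" "{b, ?m b} \<in> edges G" "{c, ?m c} \<in> edges G"
      using V edge_between by simp_all
    ultimately show "e \<in> edges G" if "e \<in> ?E" for e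
      using that by (elim insertE emptyE) simp_all
  qed
  then have "edges G = (`) g ` edges prism"
    unfolding prism_edges by (simp only: image_insert image_empty g)
  moreover have "bij_betw g (verts prism) (verts G)"
    unfolding bij_betw_def prism_verts VG
  proof
    show "g ` {(0, 0), (1, 0), (2, 0), (0, 1), (1, 1), (2, 1)} = {a, b, c, ?m a, ?m b, ?m c}"
      by (simp only: image_insert image_empty g)
    then show "inj_on g {(0, 0), (1, 0), (2, 0), (0, 1), (1, 1), (2, 1)}"
      using distinct_card[OF d] by (intro eq_card_imp_inj_on) simp_all
  qed
  moreover have "simple_graph prism"
    unfolding simple_graph_def prism_verts prism_edges by simp
  ultimately have "isomorphic prism G" using isomorphicI by blast
  then show ?thesis by (rule isomorphic_sym)
qed

section \<open>Strong edge colorings from lists of induced matchings\<close>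

text \<open>A coloring of an explicitly labelled graph is recorded as the list of its color classes, where
  each edge is a pair of positions in a list of vertices.  Two edges of one class must have no
  common end and no edge between their ends; the lists themselves say which pairs are edges,
  so that the condition can be evaluated by rewriting.\<close>

definition listed :: "(nat \<times> nat) list list \<Rightarrow> nat \<Rightarrow> nat \<Rightarrow> bool" where
  "listed Ms u v \<longleftrightarrow> (\<exists>M\<in>set Ms. (u, v) \<in> set M \<or> (v, u) \<in> set M)"

definition induced_matchings :: "nat \<Rightarrow> (nat \<times> nat) list list \<Rightarrow> bool" where
  "induced_matchings m Ms \<longleftrightarrow> (\<forall>M\<in>set Ms. \<forall>(u, v)\<in>set M. u < m \<and> v < m \<and>
     (\<forall>(u', v')\<in>set M. u = u' \<and> v = v' \<or>
        (\<forall>x\<in>{u, v}. \<forall>y\<in>{u', v'}. x \<noteq> y \<and> \<not> listed Ms x y)))"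

text \<open>The edges of \<open>G\<close> need only be among the listed pairs: listing more pairs only makes the
  conditions on the color classes stronger.\<close>

lemma strongly_edge_colorable_by_matchings:
  assumes Ms: "induced_matchings m Ms" and xs: "distinct xs" "length xs = m" and k: "length Ms = k"
    and E: "\<And>e. e \<in> edges G \<Longrightarrow> \<exists>M\<in>set Ms. \<exists>(u, v)\<in>set M. e = {xs ! u, xs ! v}"
  shows "strongly_edge_colorable k G"
proof -
  define c where "c e = (SOME k. k < length Ms \<and> (\<exists>(u, v)\<in>set (Ms ! k). e = {xs ! u, xs ! v}))" for e
  have c: "c e < length Ms \<and> (\<exists>(u, v)\<in>set (Ms ! c e). e = {xs ! u, xs ! v})"
    if "e \<in> edges G" for e
    unfolding c_def
  proof (rule someI_ex)
    show "\<exists>k<length Ms. \<exists>(u, v)\<in>set (Ms ! k). e = {xs ! u, xs ! v}"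
      using E[OF that] by (metis in_set_conv_nth)
  qed
  have bound: "u < length xs" "v < length xs" if "M \<in> set Ms" "(u, v) \<in> set M" for M u v
    using bspec[OF bspec[OF Ms[unfolded induced_matchings_def] that(1)] that(2)] xs(2) by simp_all
  have apart: "u = u' \<and> v = v' \<or> (\<forall>x\<in>{u, v}. \<forall>y\<in>{u', v'}. x \<noteq> y \<and> \<not> listed Ms x y)"
    if M: "M \<in> set Ms" "(u, v) \<in> set M" "(u', v') \<in> set M" for M u v u' v'
  proof -
    have "\<forall>(u', v')\<in>set M. u = u' \<and> v = v' \<or>
        (\<forall>x\<in>{u, v}. \<forall>y\<in>{u', v'}. x \<noteq> y \<and> \<not> listed Ms x y)"
      using bspec[OF bspec[OF Ms[unfolded induced_matchings_def] M(1)] M(2)]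
      unfolding case_prod_conv by iprover
    from bspec[OF this M(3)] show ?thesis by (simp only: case_prod_conv)
  qed
  have nth: "xs ! x = xs ! y \<longleftrightarrow> x = y" if "x < length xs" "y < length xs" for x y
    using nth_eq_iff_index_eq[OF xs(1) that] .
  have "c e \<noteq> c f"
    if e: "e \<in> edges G" and f: "f \<in> edges G" and "e \<noteq> f"
      and close: "e \<inter> f \<noteq> {} \<or> (\<exists>x\<in>e. \<exists>y\<in>f. {x, y} \<in> edges G)" for e f
  proof
    assume eq: "c e = c f"
    define M where "M = Ms ! c e"
    have M: "M \<in> set Ms" using c[OF e] by (simp add: M_def)
    obtain u v where uv: "(u, v) \<in> set M" "e = {xs ! u, xs ! v}"
      using c[OF e] by (auto simp: M_def)
    obtain u' v' where uv': "(u', v') \<in> set M" "f = {xs ! u', xs ! v'}"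
      using c[OF f] eq by (auto simp: M_def)
    obtain x y where xy: "x \<in> {u, v}" "y \<in> {u', v'}"
      and meet: "xs ! x = xs ! y \<or> {xs ! x, xs ! y} \<in> edges G"
      using close unfolding uv(2) uv'(2) by blast
    have "\<not> (u = u' \<and> v = v')" using \<open>e \<noteq> f\<close> uv uv' by auto
    then have far: "x \<noteq> y" "\<not> listed Ms x y" using apart[OF M uv(1) uv'(1)] xy by blast+
    have lt: "x < length xs" "y < length xs"
      using xy bound[OF M uv(1)] bound[OF M uv'(1)] by auto
    then have "{xs ! x, xs ! y} \<in> edges G" using meet far(1) nth by blast
    from E[OF this] obtain N a b where N: "N \<in> set Ms" "(a, b) \<in> set N"
      and ab: "{xs ! x, xs ! y} = {xs ! a, xs ! b}" by auto
    have "a = x \<and> b = y \<or> a = y \<and> b = x"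
      using ab lt bound[OF N] by (auto simp: doubleton_eq_iff nth)
    then show False using far(2) N unfolding listed_def by blast
  qed
  moreover have "c ` edges G \<subseteq> {..<length Ms}" using c by blast
  ultimately show ?thesis
    unfolding strongly_edge_colorable_def strong_edge_coloring_def k by blast
qed

lemma strongly_edge_colorable_mono:
  "strongly_edge_colorable m G \<Longrightarrow> m \<le> n \<Longrightarrow> strongly_edge_colorable n G"
  unfolding strongly_edge_colorable_def by (meson lessThan_subset_iff order_trans)

section \<open>Twelve vertices\<close>

lemma connected_closed_subset:
  assumes "connected_graph G" "S \<subseteq> verts G" "S \<noteq> {}"
    and closed: "\<And>u v. u \<in> S \<Longrightarrow> {u, v} \<in> edges G \<Longrightarrow> v \<in> S"
  shows "S = verts G"
proof
  show "verts G \<subseteq> S"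
  proof
    fix v assume v: "v \<in> verts G"
    obtain s where s: "s \<in> S" using assms(3) by blast
    then have "(s, v) \<in> {(x, y). {x, y} \<in> edges G}\<^sup>*"
      using assms(1,2) v unfolding connected_graph_def by blast
    then show "v \<in> S"
    proof induction
      case base show ?case by (rule s)
    next
      case (step y z) then show ?case using closed[of y z] by simp
    qed
  qed
qed (rule assms(2))

lemma pairs_of_triple: "{e. e \<subseteq> {a, b, c} \<and> card e = 2} \<subseteq> {{a, b}, {a, c}, {b, c}}"
proof
  fix e assume "e \<in> {e. e \<subseteq> {a, b, c} \<and> card e = 2}"
  then obtain u v where "e = {u, v}" "u \<noteq> v" "u \<in> {a, b, c}" "v \<in> {a, b, c}"
    by (auto simp: card_2_iff)
  then show "e \<in> {{a, b}, {a, c}, {b, c}}" by (elim insertE emptyE) (simp_all add: insert_commute)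
qed

context triangular_graph
begin

lemma block_member:
  assumes "X \<in> block G ` verts G" "u \<in> X"
  shows "u \<in> verts G" "block G u = X"
proof -
  obtain v where v: "v \<in> verts G" "X = block G v" using assms(1) by blast
  then show "u \<in> verts G" "block G u = X"
    using assms(2) block_subset[OF v(1)] block_cong[OF v(1)] by blast+
qed

lemma disjoint_blocks:
  assumes "X \<in> block G ` verts G" "Y \<in> block G ` verts G" "X \<noteq> Y"
  shows "X \<inter> Y = {}"
  using assms block_member(2) by blast

lemma block_eq_triple:
  assumes "X \<in> block G ` verts G" "u \<in> X" "v \<in> X" "w \<in> X" "u \<noteq> v" "u \<noteq> w" "v \<noteq> w"
  shows "X = {u, v, w}"
  using block_eqI[of u u v w] block_member[OF assms(1,2)] assms by simp

lemma mate_notin_same_block: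
  assumes "X \<in> block G ` verts G" "u \<in> X"
  shows "mate G u \<notin> X"
  using mate_notin_block[of u] block_member[OF assms] by simp

text \<open>The three edges leaving a block lead to three different blocks, and only three others exist.\<close>

lemma mate_between_blocks:
  assumes card: "card (block G ` verts G) = 4"
    and single: "\<And>u v. u \<in> verts G \<Longrightarrow> v \<in> block G u \<Longrightarrow> u \<noteq> v \<Longrightarrow>
      block G (mate G u) \<noteq> block G (mate G v)"
    and X: "X \<in> block G ` verts G" and Y: "Y \<in> block G ` verts G" "X \<noteq> Y"
  obtains x where "x \<in> X" "mate G x \<in> Y"
proof -
  let ?P = "block G ` verts G"
  let ?N = "(\<lambda>x. block G (mate G x)) ` X"
  obtain v where v: "v \<in> verts G" "X = block G v" using X by blast
  have fin: "finite ?P" using card by (intro card_ge_0_finite) simp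
  have "inj_on (\<lambda>x. block G (mate G x)) X"
    unfolding inj_on_def using single block_member[OF X] by blast
  then have "card ?N = 3" using card_block[OF v(1)] v(2) by (simp add: card_image)
  moreover have "?N \<subseteq> ?P - {X}"
    using mate_in_verts block_member[OF X] mate_notin_same_block[OF X] mem_block_self by blast
  moreover have "card (?P - {X}) = 3" using card X fin by simp
  ultimately have "?N = ?P - {X}" using fin by (intro card_subset_eq) auto
  then have "Y \<in> ?N" using Y by simp
  then show thesis using that by auto
qed

lemma edges_subset:
  "edges G \<subseteq> (\<Union>X\<in>block G ` verts G. {e. e \<subseteq> X \<and> card e = 2}) \<union> (\<lambda>v. {v, mate G v}) ` verts G"
proof
  fix e assume "e \<in> edges G"
  then show "e \<in> (\<Union>X\<in>block G ` verts G. {e. e \<subseteq> X \<and> card e = 2}) \<union> (\<lambda>v. {v, mate G v}) ` verts G"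
    by (cases rule: edgeE) auto
qed

end

text \<open>A strong coloring with six colors of the truncation of \<open>K\<^sub>4\<close>.  Positions \<open>3i, 3i + 1, 3i + 2\<close>
  hold the vertices of the \<open>i\<close>-th block, ordered by the block in which their mates lie.\<close>

definition k4_matchings :: "(nat \<times> nat) list list" where
  "k4_matchings =
  [[(0, 1), (10, 11), (4, 7)],
   [(0, 2), (6, 7), (5, 10)],
   [(1, 2), (3, 4), (8, 11)],
   [(3, 5), (6, 8), (2, 9)],
   [(4, 5), (9, 11), (1, 6)],
   [(7, 8), (9, 10), (0, 3)]]"

lemma induced_k4_matchings: "induced_matchings 12 k4_matchings"
  unfolding induced_matchings_def listed_def k4_matchings_def by simp

lemma (in triangular_graph) colorable_if_single_edges_between_blocks:
  assumes card: "card (verts G) = 12"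
    and single: "\<And>u v. u \<in> verts G \<Longrightarrow> v \<in> block G u \<Longrightarrow> u \<noteq> v \<Longrightarrow>
      block G (mate G u) \<noteq> block G (mate G v)"
  shows "strongly_edge_colorable 6 G"
proof -
  let ?P = "block G ` verts G" and ?m = "mate G"
  have fin: "finite (verts G)" using card by (intro card_ge_0_finite) simp
  then have cardP: "card ?P = 4" using card_blocks card by simp
  have "finite ?P" using fin by simp
  then obtain Xs where Xs: "set Xs = ?P" "distinct Xs" "length Xs = 4"
    using finite_distinct_list distinct_card cardP by metis
  from Xs(3) obtain X0 X1 X2 X3 where "Xs = [X0, X1, X2, X3]"
    by (auto simp: numeral_eq_Suc length_Suc_conv)
  then have P: "?P = {X0, X1, X2, X3}" and dX: "distinct [X0, X1, X2, X3]"
    using Xs by simp_all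
  have XP: "X0 \<in> ?P" "X1 \<in> ?P" "X2 \<in> ?P" "X3 \<in> ?P" using P by auto
  have disj: "X0 \<inter> X1 = {}" "X0 \<inter> X2 = {}" "X0 \<inter> X3 = {}" "X1 \<inter> X2 = {}" "X1 \<inter> X3 = {}" "X2 \<inter> X3 = {}"
    using XP dX by (simp_all add: disjoint_blocks)
  note between = mate_between_blocks[OF cardP single]
  obtain a1 where a1: "a1 \<in> X0" "?m a1 \<in> X1" using between[OF _ _ _ XP(1,2)] dX by auto
  obtain a2 where a2: "a2 \<in> X0" "?m a2 \<in> X2" using between[OF _ _ _ XP(1,3)] dX by auto
  obtain a3 where a3: "a3 \<in> X0" "?m a3 \<in> X3" using between[OF _ _ _ XP(1,4)] dX by auto
  obtain b2 where b2: "b2 \<in> X1" "?m b2 \<in> X2" using between[OF _ _ _ XP(2,3)] dX by auto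
  obtain b3 where b3: "b3 \<in> X1" "?m b3 \<in> X3" using between[OF _ _ _ XP(2,4)] dX by auto
  obtain c3 where c3: "c3 \<in> X2" "?m c3 \<in> X3" using between[OF _ _ _ XP(3,4)] dX by auto
  have V: "a1 \<in> verts G" "a2 \<in> verts G" "a3 \<in> verts G" "b2 \<in> verts G" "b3 \<in> verts G" "c3 \<in> verts G"
    using block_member(1) XP a1 a2 a3 b2 b3 c3 by blast+
  note mm = V[THEN mate_mate]
  have ne: "u \<noteq> v" if "?m u \<in> X" "?m v \<in> Y" "X \<inter> Y = {}" for u v X Y
    using that by blast
  have mates: "?m (?m a1) \<in> X0" "?m (?m a2) \<in> X0" "?m (?m a3) \<in> X0"
    "?m (?m b2) \<in> X1" "?m (?m b3) \<in> X1" "?m (?m c3) \<in> X2"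
    using a1 a2 a3 b2 b3 c3 mm by simp_all
  have X0: "X0 = {a1, a2, a3}"
    by (rule block_eq_triple[OF XP(1) a1(1) a2(1) a3(1)
      ne[OF a1(2) a2(2) disj(4)] ne[OF a1(2) a3(2) disj(5)] ne[OF a2(2) a3(2) disj(6)]])
  have X1: "X1 = {?m a1, b2, b3}"
    by (rule block_eq_triple[OF XP(2) a1(2) b2(1) b3(1)
      ne[OF mates(1) b2(2) disj(2)] ne[OF mates(1) b3(2) disj(3)] ne[OF b2(2) b3(2) disj(6)]])
  have X2: "X2 = {?m a2, ?m b2, c3}"
    by (rule block_eq_triple[OF XP(3) a2(2) b2(2) c3(1)
      ne[OF mates(2) mates(4) disj(1)] ne[OF mates(2) c3(2) disj(3)] ne[OF mates(4) c3(2) disj(5)]])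
  have X3: "X3 = {?m a3, ?m b3, ?m c3}"
    by (rule block_eq_triple[OF XP(4) a3(2) b3(2) c3(2)
      ne[OF mates(3) mates(5) disj(1)] ne[OF mates(3) mates(6) disj(2)] ne[OF mates(5) mates(6) disj(4)]])
  let ?xs = "[a1, a2, a3, ?m a1, b2, b3, ?m a2, ?m b2, c3, ?m a3, ?m b3, ?m c3]"
  have VG: "verts G = set ?xs" using Union_blocks P unfolding X0 X1 X2 X3 by auto
  have d: "distinct ?xs" by (rule card_distinct) (use card in \<open>simp add: VG\<close>)
  let ?S = "{{a1, a2}, {a1, a3}, {a2, a3}, {?m a1, b2}, {?m a1, b3}, {b2, b3},
    {?m a2, ?m b2}, {?m a2, c3}, {?m b2, c3}, {?m a3, ?m b3}, {?m a3, ?m c3}, {?m b3, ?m c3},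
    {a1, ?m a1}, {a2, ?m a2}, {a3, ?m a3}, {b2, ?m b2}, {b3, ?m b3}, {c3, ?m c3}}"
  have "edges G \<subseteq> (\<Union>X\<in>?P. {e. e \<subseteq> X \<and> card e = 2}) \<union> (\<lambda>v. {v, ?m v}) ` verts G"
    by (rule edges_subset)
  also have "\<dots> \<subseteq> ?S"
    unfolding P X0 X1 X2 X3 UN_insert UN_empty
  proof (intro Un_least order_trans[OF pairs_of_triple])
    show "(\<lambda>v. {v, ?m v}) ` verts G \<subseteq> ?S"
      unfolding VG list.set image_insert image_empty mm by (simp add: insert_commute)
  qed simp_all
  finally have S: "edges G \<subseteq> ?S" .
  show ?thesis
  proof (rule strongly_edge_colorable_by_matchings[OF induced_k4_matchings d])
    fix e assume "e \<in> edges G"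
    then have "e \<in> ?S" by (rule subsetD[OF S])
    then show "\<exists>M\<in>set k4_matchings. \<exists>(u, v)\<in>set M. e = {?xs ! u, ?xs ! v}"
      unfolding k4_matchings_def by (elim insertE emptyE) simp_all
  qed (simp_all add: k4_matchings_def)
qed

text \<open>A strong coloring with six colors of the graph whose four blocks \<open>0, 1, 3, 2\<close> form a cycle in this order,
  with two edges between blocks 0 and 1, two between blocks 2 and 3, and one edge between blocks 0
  and 2 and between blocks 1 and 3.  Positions \<open>3i, 3i + 1, 3i + 2\<close> hold the vertices of the
  \<open>i\<close>-th block, the first of which has its mate in block 2, 3, 0, 1 for \<open>i = 0, 1, 2, 3\<close>.\<close>

definition four_cycle_matchings :: "(nat \<times> nat) list list" where
  "four_cycle_matchings =
  [[(0, 1), (3, 5), (7, 10)],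
   [(0, 2), (3, 4), (8, 11)],
   [(1, 2), (7, 8), (3, 9)],
   [(4, 5), (10, 11), (0, 6)],
   [(6, 7), (9, 11), (1, 4)],
   [(6, 8), (9, 10), (2, 5)]]"

lemma induced_four_cycle_matchings: "induced_matchings 12 four_cycle_matchings"
  unfolding induced_matchings_def listed_def four_cycle_matchings_def by simp

text \<open>Let \<open>X\<close> and \<open>Y\<close> be the two blocks joined by two edges, and \<open>a0\<close>, \<open>b0\<close> their
  remaining vertices.  By connectedness these two are not adjacent, so their mates lie in
  other blocks \<open>Z\<close> and \<open>W\<close>.  If \<open>Z\<close> and \<open>W\<close> were equal, only one edge could reach the
  fourth block.  So they are the third and the fourth block, and the mates of the other two vertices
  of \<open>Z\<close> have no place except in \<open>W\<close>.\<close>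

lemma (in triangular_graph) colorable_if_double_edge_between_blocks:
  assumes conn: "connected_graph G" and card: "card (verts G) = 12"
    and a: "a1 \<in> verts G" "a2 \<in> block G a1" "a1 \<noteq> a2"
    and double: "block G (mate G a1) = block G (mate G a2)"
  shows "strongly_edge_colorable 6 G"
proof -
  let ?P = "block G ` verts G" and ?m = "mate G"
  have fin: "finite (verts G)" using card by (intro card_ge_0_finite) simp
  then have cardP: "card ?P = 4" and finP: "finite ?P" using card_blocks card by auto
  define X where "X = block G a1"
  define Y where "Y = block G (?m a1)"
  have a2: "a2 \<in> verts G" using block_subset[OF a(1)] a(2) by blast
  have XP: "X \<in> ?P" and YP: "Y \<in> ?P" using a(1) mate_in_verts by (auto simp: X_def Y_def)
  have inX: "a1 \<in> X" "a2 \<in> X" using a(2) by (simp_all add: X_def)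
  have inY: "?m a1 \<in> Y" by (simp add: Y_def)
  have "?m a2 \<in> Y" unfolding Y_def double by (rule mem_block_self)
  note inY = inY this
  have "X \<noteq> Y" using mate_notin_same_block[OF XP inX(1)] inY by blast
  have triple: "\<exists>w. Z = {u, v, w} \<and> w \<noteq> u \<and> w \<noteq> v" if "Z \<in> ?P" "u \<in> Z" "v \<in> Z" "u \<noteq> v" for Z u v
  proof -
    have "card Z = 3" using that(1) card_block by auto
    then have "Z - {u, v} \<noteq> {}" using card_mono[of "{u, v}" Z] that(4) by auto
    then obtain w where "w \<in> Z" "w \<noteq> u" "w \<noteq> v" by blast
    then show ?thesis using block_eq_triple[OF that(1,2,3), of w] that(4) by blast
  qed
  obtain a0 where a0: "X = {a1, a2, a0}" "a0 \<noteq> a1" "a0 \<noteq> a2"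
    using triple[OF XP inX a(3)] by blast
  have "?m a1 \<noteq> ?m a2" using mate_eq_iff[OF a(1) a2] a(3) by simp
  then obtain b0 where b0: "Y = {?m a1, ?m a2, b0}" "b0 \<noteq> ?m a1" "b0 \<noteq> ?m a2"
    using triple[OF YP inY] by blast
  have V: "a0 \<in> verts G" "a1 \<in> verts G" "a2 \<in> verts G" "b0 \<in> verts G"
    using block_member(1)[OF XP] block_member(1)[OF YP] a0 b0 a(1) by blast+
  note mV = V[THEN mate_in_verts] and mm = V[THEN mate_mate]
  have into_X: "v \<in> {?m a0, ?m a1, ?m a2}" if "v \<in> verts G" "?m v \<in> X" for v
    using imageI[OF that(2), of ?m] unfolding mate_mate[OF that(1)] a0(1) by auto
  have into_Y: "v \<in> {a1, a2, ?m b0}" if "v \<in> verts G" "?m v \<in> Y" for v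
    using imageI[OF that(2), of ?m] unfolding mate_mate[OF that(1)] b0(1) image_insert mm by simp
  have disjXY: "X \<inter> Y = {}" using disjoint_blocks[OF XP YP \<open>X \<noteq> Y\<close>] .

  \<comment> \<open>Otherwise no edge leaves the six vertices of the two blocks.\<close>
  have "?m a0 \<noteq> b0"
  proof
    assume eq: "?m a0 = b0"
    have closed: "v \<in> X \<union> Y" if u: "u \<in> X \<union> Y" and uv: "{u, v} \<in> edges G" for u v
    proof -
      have "u \<in> verts G" using u XP YP block_member(1) by blast
      then have "v = ?m u \<or> v \<in> block G u" using uv nbrs_eq[of u] by (auto simp: nbrs_def)
      moreover have "block G u = X \<or> block G u = Y" using u block_member(2) XP YP by blast
      moreover have "?m u \<in> X \<union> Y" using u eq mm unfolding a0(1) b0(1) by auto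
      ultimately show ?thesis by blast
    qed
    have "X \<union> Y = verts G"
      by (rule connected_closed_subset[OF conn])
        (use closed inX block_member(1) XP YP in blast)+
    moreover have "card (X \<union> Y) \<le> card X + card Y" by (rule card_Un_le)
    moreover have "card X = 3" "card Y = 3" using XP YP card_block by auto
    ultimately show False using card by simp
  qed

  define Z where "Z = block G (?m a0)"
  define W where "W = block G (?m b0)"
  have ZP: "Z \<in> ?P" and WP: "W \<in> ?P" using mV by (auto simp: Z_def W_def)
  have inZ: "?m a0 \<in> Z" and inW: "?m b0 \<in> W" by (simp_all add: Z_def W_def)
  have aX: "a0 \<in> X" and bY: "b0 \<in> Y" using a0(1) b0(1) by simp_all
  have "Z \<noteq> X" using mate_notin_same_block[OF XP aX] inZ by blast
  have "W \<noteq> Y" using mate_notin_same_block[OF YP bY] inW by blast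
  have "Z \<noteq> Y"
  proof
    assume "Z = Y"
    then have "?m a0 \<in> {?m a1, ?m a2}" using inZ b0(1) \<open>?m a0 \<noteq> b0\<close> by blast
    then show False using a0(2,3) by (simp add: mate_eq_iff V)
  qed
  have "W \<noteq> X"
  proof
    assume "W = X"
    then show False using into_X[OF V(4)] inW b0(2,3) \<open>?m a0 \<noteq> b0\<close> by blast
  qed
  have disj: "X \<inter> Z = {}" "Y \<inter> Z = {}" "X \<inter> W = {}" "Y \<inter> W = {}"
    using disjoint_blocks XP YP ZP WP \<open>Z \<noteq> X\<close> \<open>Z \<noteq> Y\<close> \<open>W \<noteq> X\<close> \<open>W \<noteq> Y\<close> by metis+
  \<comment> \<open>In another block, only the mates of \<open>a0\<close> and \<open>b0\<close> have neighbours in \<open>X\<close> or \<open>Y\<close>.\<close>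
  have away: "?m v \<notin> X" "?m v \<notin> Y" "?m v \<notin> U"
    if "U \<in> ?P" "v \<in> U" "U \<noteq> X" "U \<noteq> Y" "v \<noteq> ?m a0" "v \<noteq> ?m b0" for v U
  proof -
    have v: "v \<in> verts G" "v \<notin> X" "v \<notin> Y"
      using block_member[OF that(1,2)] block_member(2)[OF XP] block_member(2)[OF YP] that(3,4) by metis+
    show "?m v \<notin> X" using into_X[OF v(1)] v(3) inY that(5) by blast
    show "?m v \<notin> Y" using into_Y[OF v(1)] v(2) inX that(6) by blast
    show "?m v \<notin> U" by (rule mate_notin_same_block[OF that(1,2)])
  qed
  have P_if: "?P = {X, Y, Z, U}" if "U \<in> ?P" "U \<notin> {X, Y, Z}" for U
  proof -
    have "X \<noteq> U" "Y \<noteq> U" "Z \<noteq> U" "X \<noteq> Z" "Y \<noteq> Z"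
      using that(2) \<open>Z \<noteq> X\<close> \<open>Z \<noteq> Y\<close> by blast+
    then have "card {X, Y, Z, U} = 4" using \<open>X \<noteq> Y\<close> by simp
    then show ?thesis using card_subset_eq[OF finP, of "{X, Y, Z, U}"] cardP XP YP ZP that(1) by simp
  qed

  \<comment> \<open>Otherwise the third vertex of \<open>Z\<close> would have to be the mate of all vertices of the
    fourth block.\<close>
  have "W \<noteq> Z"
  proof
    assume "W = Z"
    have "?m a0 \<noteq> ?m b0" using mate_eq_iff[OF V(1,4)] aX bY disjXY by auto
    then obtain z where z: "Z = {?m a0, ?m b0, z}" "z \<noteq> ?m a0" "z \<noteq> ?m b0"
      using triple[OF ZP inZ] inW \<open>W = Z\<close> by blast
    have "card {X, Y, Z} < card ?P" using card_length[of "[X, Y, Z]"] cardP by simp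
    then have "\<not> ?P \<subseteq> {X, Y, Z}" using card_mono[of "{X, Y, Z}" ?P] by auto
    then obtain U where U: "U \<in> ?P" "U \<notin> {X, Y, Z}" by blast
    have VU: "verts G = X \<union> Y \<union> Z \<union> U" using Union_blocks P_if[OF U] by auto
    obtain u where u: "U = block G u" "u \<in> verts G" using U by blast
    have "\<not> U \<subseteq> {?m z}" using card_mono[of "{?m z}" U] card_block[OF u(2)] u(1) by auto
    then obtain w where w: "w \<in> U" "w \<noteq> ?m z" by blast
    have wV: "w \<in> verts G" using block_member(1)[OF U(1) w(1)] .
    have "U \<inter> Z = {}" using disjoint_blocks[OF U(1) ZP] U(2) by blast
    then have wZ: "w \<noteq> ?m a0" "w \<noteq> ?m b0" using w(1) z(1) by auto
    then have "?m w \<notin> X \<union> Y \<union> U" using away[OF U(1) w(1)] U(2) by blast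
    then have "?m w \<in> {?m a0, ?m b0, z}" using mate_in_verts[OF wV] VU z(1) by blast
    then have "w = a0 \<or> w = b0 \<or> ?m w = z" using mate_eq_iff wV V by auto
    moreover have "w \<noteq> a0" "w \<noteq> b0"
      using w(1) aX bY disjoint_blocks[OF U(1) XP] disjoint_blocks[OF U(1) YP] U(2) by blast+
    moreover have "?m w \<noteq> z" using w(2) mate_mate[OF wV] by auto
    ultimately show False by blast
  qed

  then have P: "?P = {X, Y, Z, W}" using P_if[OF WP] \<open>W \<noteq> X\<close> \<open>W \<noteq> Y\<close> by blast
  have VU: "verts G = X \<union> Y \<union> Z \<union> W" using Union_blocks P by auto
  have disjZW: "Z \<inter> W = {}" using disjoint_blocks[OF ZP WP] \<open>W \<noteq> Z\<close> by blast
  have "card Z = 3" using card_block mV(1) by (simp add: Z_def)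
  then have "card (Z - {?m a0}) = 2" using inZ by simp
  then obtain c1 c2 where c: "Z - {?m a0} = {c1, c2}" "c1 \<noteq> c2" by (auto simp: card_2_iff)
  then have Z: "Z = {?m a0, c1, c2}" and c0: "c1 \<noteq> ?m a0" "c2 \<noteq> ?m a0" using inZ by auto
  have cV: "c1 \<in> verts G" "c2 \<in> verts G" using VU Z by auto
  have into_W: "?m v \<in> W" if "v \<in> Z" "v \<noteq> ?m a0" for v
  proof -
    have "v \<noteq> ?m b0" using that(1) inW disjZW by blast
    then have "?m v \<notin> X \<union> Y \<union> Z" using away[OF ZP that(1) \<open>Z \<noteq> X\<close> \<open>Z \<noteq> Y\<close> that(2)] by blast
    moreover have "v \<in> verts G" using block_member(1)[OF ZP that(1)] .
    ultimately show ?thesis using mate_in_verts VU by blast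
  qed
  have W: "W = {?m b0, ?m c1, ?m c2}"
  proof (rule block_eq_triple[OF WP inW])
    show "?m c1 \<in> W" "?m c2 \<in> W" using into_W Z c0 by auto
    have "b0 \<notin> Z" using bY disj(2) by blast
    then show "?m b0 \<noteq> ?m c1" "?m b0 \<noteq> ?m c2" "?m c1 \<noteq> ?m c2"
      using Z c(2) by (auto simp: mate_eq_iff V cV)
  qed
  note mm = mm cV[THEN mate_mate]
  let ?xs = "[a0, a1, a2, b0, ?m a1, ?m a2, ?m a0, c1, c2, ?m b0, ?m c1, ?m c2]"
  have VG: "verts G = set ?xs" unfolding VU a0(1) b0(1) Z W by auto
  have d: "distinct ?xs" by (rule card_distinct) (use card in \<open>simp add: VG\<close>)
  let ?S = "{{a1, a2}, {a1, a0}, {a2, a0}, {?m a1, ?m a2}, {?m a1, b0}, {?m a2, b0},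
    {?m a0, c1}, {?m a0, c2}, {c1, c2}, {?m b0, ?m c1}, {?m b0, ?m c2}, {?m c1, ?m c2},
    {a0, ?m a0}, {a1, ?m a1}, {a2, ?m a2}, {b0, ?m b0}, {c1, ?m c1}, {c2, ?m c2}}"
  have "edges G \<subseteq> (\<Union>X\<in>?P. {e. e \<subseteq> X \<and> card e = 2}) \<union> (\<lambda>v. {v, ?m v}) ` verts G"
    by (rule edges_subset)
  also have "\<dots> \<subseteq> ?S"
    unfolding P a0(1) b0(1) Z W UN_insert UN_empty
  proof (intro Un_least order_trans[OF pairs_of_triple])
    show "(\<lambda>v. {v, ?m v}) ` verts G \<subseteq> ?S"
      unfolding VG list.set image_insert image_empty mm by (simp add: insert_commute)
  qed simp_all
  finally have S: "edges G \<subseteq> ?S" .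
  show ?thesis
  proof (rule strongly_edge_colorable_by_matchings[OF induced_four_cycle_matchings d])
    fix e assume "e \<in> edges G"
    then have "e \<in> ?S" by (rule subsetD[OF S])
    then show "\<exists>M\<in>set four_cycle_matchings. \<exists>(u, v)\<in>set M. e = {?xs ! u, ?xs ! v}"
      unfolding four_cycle_matchings_def by (elim insertE emptyE) (simp_all add: insert_commute)
  qed (simp_all add: four_cycle_matchings_def)
qed

section \<open>The graph Q has no strong coloring with six colors\<close>

text \<open>Any two of these six edges share an end or are joined by an edge of the triangle.\<close>

lemma triangle_colors:
  assumes c: "strong_edge_coloring G c" "c ` edges G \<subseteq> {..<6}"
    and E: "{p, q} \<in> edges G" "{q, r} \<in> edges G" "{p, r} \<in> edges G"
      "{p, p'} \<in> edges G" "{q, q'} \<in> edges G" "{r, r'} \<in> edges G"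
    and d: "distinct [{p, q}, {q, r}, {p, r}, {p, p'}, {q, q'}, {r, r'}]"
  shows "distinct [c {p, q}, c {q, r}, c {p, r}, c {p, p'}, c {q, q'}, c {r, r'}]"
    and "{c {p, q}, c {q, r}, c {p, r}, c {p, p'}, c {q, q'}, c {r, r'}} = {..<6}"
proof -
  have ne: "c e \<noteq> c f" if "e \<in> edges G" "f \<in> edges G" "e \<noteq> f"
    "x \<in> e" "y \<in> f" "x = y \<or> {x, y} \<in> edges G" for e f x y
    using c(1) that unfolding strong_edge_coloring_def by blast
  show dist: "distinct [c {p, q}, c {q, r}, c {p, r}, c {p, p'}, c {q, q'}, c {r, r'}]"
    using d ne[of "{p, q}" "{q, r}" q q] ne[of "{p, q}" "{p, r}" p p] ne[of "{q, r}" "{p, r}" r r]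
      ne[of "{p, q}" "{p, p'}" p p] ne[of "{p, q}" "{q, q'}" q q] ne[of "{p, q}" "{r, r'}" p r]
      ne[of "{q, r}" "{p, p'}" q p] ne[of "{q, r}" "{q, q'}" q q] ne[of "{q, r}" "{r, r'}" r r]
      ne[of "{p, r}" "{p, p'}" p p] ne[of "{p, r}" "{q, q'}" p q] ne[of "{p, r}" "{r, r'}" r r]
      ne[of "{p, p'}" "{q, q'}" p q] ne[of "{p, p'}" "{r, r'}" p r] ne[of "{q, q'}" "{r, r'}" q r]
    by (simp add: E insert_commute)
  have "{c {p, q}, c {q, r}, c {p, r}, c {p, p'}, c {q, q'}, c {r, r'}} \<subseteq> {..<6}"
    using c(2) E by blast
  moreover have "card {c {p, q}, c {q, r}, c {p, r}, c {p, p'}, c {q, q'}, c {r, r'}} = 6"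
    using distinct_card[OF dist] by simp
  ultimately show "{c {p, q}, c {q, r}, c {p, r}, c {p, p'}, c {q, q'}, c {r, r'}} = {..<6}"
    by (intro card_subset_eq) auto
qed

text \<open>The triangles on the \<open>b\<close>'s and the \<open>d\<close>'s (for the c's of Q) use all six
  colors, and together they fix two colors that the edges of the triangle on the \<open>a\<close>'s cannot
  have.  The contradiction lies within the copy of Q, whatever else the graph contains.\<close>

lemma not_strongly_edge_colorable_if_Q:
  assumes inj: "distinct [a0, a1, a2, b0, b1, b2, d0, d1, d2]"
    and A: "{a0, a1} \<in> edges G" "{a1, a2} \<in> edges G" "{a0, a2} \<in> edges G"
    and B: "{b0, b1} \<in> edges G" "{b1, b2} \<in> edges G" "{b0, b2} \<in> edges G"
    and D: "{d0, d1} \<in> edges G" "{d1, d2} \<in> edges G" "{d0, d2} \<in> edges G"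
    and M: "{a0, b0} \<in> edges G" "{a1, d0} \<in> edges G" "{b1, d1} \<in> edges G" "{b2, d2} \<in> edges G"
  shows "\<not> strongly_edge_colorable 6 G"
proof
  assume "strongly_edge_colorable 6 G"
  then obtain c where c: "strong_edge_coloring G c" "c ` edges G \<subseteq> {..<6}"
    unfolding strongly_edge_colorable_def by blast
  have M': "{b0, a0} \<in> edges G" "{d0, a1} \<in> edges G" "{d1, b1} \<in> edges G" "{d2, b2} \<in> edges G"
    using M by (simp_all add: insert_commute)
  have ne: "c e \<noteq> c f" if "{x, y} \<in> edges G" "x \<in> e" "y \<in> f" "e \<in> edges G" "f \<in> edges G" "e \<noteq> f" for e f x y
    using c(1) that unfolding strong_edge_coloring_def by blast
  have inj': "distinct [d2, d1, d0, b2, b1, b0, a2, a1, a0]"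
    using inj distinct_rev[of "[a0, a1, a2, b0, b1, b2, d0, d1, d2]"] by (simp only: rev.simps append.simps)
  have dB: "distinct [{b0, b1}, {b1, b2}, {b0, b2}, {b0, a0}, {b1, d1}, {b2, d2}]"
    using inj inj' by (simp add: doubleton_eq_iff)
  have dD: "distinct [{d0, d1}, {d1, d2}, {d0, d2}, {d0, a1}, {d1, b1}, {d2, b2}]"
    using inj inj' by (simp add: doubleton_eq_iff)
  note TB = triangle_colors[OF c B M'(1) M(3,4) dB]
  note TD = triangle_colors[OF c D M'(2,3,4) dD]
  have comm: "{b0, a0} = {a0, b0}" "{d0, a1} = {a1, d0}" "{d1, b1} = {b1, d1}" "{d2, b2} = {b2, d2}"
    by auto
  note TB = TB[unfolded comm] and TD = TD[unfolded comm]
  have full: "c e \<in> {..<6}" if "e \<in> edges G" for e using c(2) that by blast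
  have BD: "c {b0, b1} \<noteq> c {d0, d1}" "c {b0, b1} \<noteq> c {d1, d2}"
      "c {b0, b2} \<noteq> c {d0, d2}" "c {b0, b2} \<noteq> c {d1, d2}"
      "c {b1, b2} \<noteq> c {d0, d1}" "c {b1, b2} \<noteq> c {d1, d2}" "c {b1, b2} \<noteq> c {d0, d2}"
    using ne[OF M(3)] ne[OF M(4)] B D inj inj' by (simp_all add: doubleton_eq_iff)
  have AB: "c {a0, a1} \<noteq> c {b0, b1}" "c {a0, a1} \<noteq> c {b0, b2}"
      "c {a0, a2} \<noteq> c {b0, b1}" "c {a0, a2} \<noteq> c {b0, b2}"
    using ne[OF M(1)] A B inj inj' by (simp_all add: doubleton_eq_iff)
  have AD: "c {a1, a2} \<noteq> c {d0, d1}" "c {a1, a2} \<noteq> c {d0, d2}"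
    using ne[OF M(2)] A D inj inj' by (simp_all add: doubleton_eq_iff)
  \<comment> \<open>Every color occurs at the triangle of the \<open>d\<close>'s.  For the edge \<open>{b1, b2}\<close> all but
    one of them are excluded by conflicts, and then the same holds for the other two edges.\<close>
  have "c {b1, b2} = c {a1, d0}"
    using full[OF B(2)] BD TB(1) unfolding TD(2)[symmetric] by simp
  moreover from this have "c {b0, b1} = c {d0, d2}" "c {b0, b2} = c {d0, d1}"
    using full[OF B(1)] full[OF B(3)] BD TB(1) unfolding TD(2)[symmetric] by auto
  moreover have "c {a0, a1} \<noteq> c {a1, a2}" "c {a0, a1} \<noteq> c {a0, a2}" "c {a1, a2} \<noteq> c {a0, a2}"
      "c {a0, a1} \<noteq> c {a0, b0}" "c {a1, a2} \<noteq> c {a0, b0}" "c {a0, a2} \<noteq> c {a0, b0}"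
      "c {a0, a1} \<noteq> c {a1, d0}" "c {a1, a2} \<noteq> c {a1, d0}" "c {a0, a2} \<noteq> c {a1, d0}"
      "c {a0, b0} \<noteq> c {a1, d0}"
    using ne[OF A(1), of "{a0, a1}" "{a1, a2}"] ne[OF A(1), of "{a0, a2}" "{a0, a1}"]
      ne[OF A(1), of "{a0, a2}" "{a1, a2}"] ne[OF A(1), of "{a0, b0}" "{a0, a1}"]
      ne[OF A(1), of "{a0, b0}" "{a1, a2}"] ne[OF A(3), of "{a0, b0}" "{a0, a2}"]
      ne[OF A(1), of "{a0, a1}" "{a1, d0}"] ne[OF A(2), of "{a1, d0}" "{a1, a2}"]
      ne[OF A(1), of "{a0, a2}" "{a1, d0}"] ne[OF A(1), of "{a0, b0}" "{a1, d0}"]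
      A M inj inj' by (simp_all add: doubleton_eq_iff)
  ultimately have seven: "distinct [c {a0, a1}, c {a1, a2}, c {a0, a2}, c {a0, b0}, c {a1, d0},
      c {b0, b1}, c {b0, b2}]"
    using AB AD TB(1) by auto
  have "set [c {a0, a1}, c {a1, a2}, c {a0, a2}, c {a0, b0}, c {a1, d0}, c {b0, b1}, c {b0, b2}] \<subseteq> {..<6}"
    using full A B M by simp
  from card_mono[OF finite_lessThan this] show False unfolding distinct_card[OF seven] by simp
qed

section \<open>The graph H\<close>

lemma nbrs_Q:
  "nbrs graph_Q A0 = {A1, A2, B0}" "nbrs graph_Q A1 = {A0, A2, C0}" "nbrs graph_Q A2 = {A0, A1}"
  "nbrs graph_Q B0 = {B1, B2, A0}" "nbrs graph_Q B1 = {B0, B2, C1}" "nbrs graph_Q B2 = {B0, B1, C2}"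
  "nbrs graph_Q C0 = {C1, C2, A1}" "nbrs graph_Q C1 = {C0, C2, B1}" "nbrs graph_Q C2 = {C0, C1, B2}"
  by (auto simp: nbrs_def graph_Q_def doubleton_eq_iff)

lemma Q_edge_iff: "{u, v} \<in> edges graph_Q \<longleftrightarrow> v \<in> nbrs graph_Q u"
  by (simp add: nbrs_def)

lemma Q_locally_triangular:
  assumes "q \<noteq> A2"
  shows "\<exists>x y z. distinct [x, y, z] \<and> nbrs graph_Q q = {x, y, z} \<and>
     {x, y} \<in> edges graph_Q \<and> {x, z} \<notin> edges graph_Q \<and> {y, z} \<notin> edges graph_Q"
proof -
  have "\<exists>x y z. nbrs graph_Q q = {x, y, z} \<and> distinct [x, y, z] \<and>
     y \<in> nbrs graph_Q x \<and> z \<notin> nbrs graph_Q x \<and> z \<notin> nbrs graph_Q y"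
    using assms by (cases q; simp only: nbrs_Q simp_thms)
      (intro exI conjI, rule refl, simp_all add: nbrs_Q)+
  then show ?thesis unfolding Q_edge_iff by blast
qed

lemma H_edge_iff:
  "{Inl u, Inl v} \<in> edges graph_H \<longleftrightarrow> {u, v} \<in> edges graph_Q"
  "{Inr u, Inr v} \<in> edges graph_H \<longleftrightarrow> {u, v} \<in> edges graph_Q"
  "{Inl u, Inr v} \<in> edges graph_H \<longleftrightarrow> u = A2 \<and> v = A2"
  "{Inr v, Inl u} \<in> edges graph_H \<longleftrightarrow> u = A2 \<and> v = A2"
proof -
  have inj: "inj ((`) f)" if "inj f" for f :: "qvert \<Rightarrow> qvert + qvert"
    using that by (simp add: inj_def[of "(`) f"] inj_image_eq_iff)
  have l: "{Inl u, Inl v :: qvert + qvert} \<in> (`) Inl ` E \<longleftrightarrow> {u, v} \<in> E" for u v :: qvert and E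
    using inj_image_mem_iff[OF inj[of Inl], of "{u, v}" E] by simp
  have r: "{Inr u, Inr v :: qvert + qvert} \<in> (`) Inr ` E \<longleftrightarrow> {u, v} \<in> E" for u v :: qvert and E
    using inj_image_mem_iff[OF inj[of Inr], of "{u, v}" E] by simp
  have "Inl w \<notin> e" if "e \<in> (`) Inr ` E" for w :: qvert and e and E :: "qvert set set" using that by auto
  moreover have "Inr w \<notin> e" if "e \<in> (`) Inl ` E" for w :: qvert and e and E :: "qvert set set" using that by auto
  ultimately have "{Inl u, Inl v} \<notin> (`) Inr ` E" "{Inr u, Inr v} \<notin> (`) Inl ` E"
    "{Inl u, Inr v} \<notin> (`) Inl ` E" "{Inl u, Inr v} \<notin> (`) Inr ` E" for u v :: qvert and E
    by (meson insertI1 insertI2)+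
  then show "{Inl u, Inl v} \<in> edges graph_H \<longleftrightarrow> {u, v} \<in> edges graph_Q"
    "{Inr u, Inr v} \<in> edges graph_H \<longleftrightarrow> {u, v} \<in> edges graph_Q"
    and m: "{Inl u, Inr v} \<in> edges graph_H \<longleftrightarrow> u = A2 \<and> v = A2"
    unfolding graph_H_def by (simp_all add: l r doubleton_eq_iff)
  show "{Inr v, Inl u} \<in> edges graph_H \<longleftrightarrow> u = A2 \<and> v = A2"
    using m by (simp add: insert_commute)
qed

lemma nbrs_H:
  "nbrs graph_H (Inl q) = Inl ` nbrs graph_Q q \<union> (if q = A2 then {Inr A2} else {})"
  "nbrs graph_H (Inr q) = Inr ` nbrs graph_Q q \<union> (if q = A2 then {Inl A2} else {})"
proof -
  have "w \<in> nbrs graph_H (Inl q) \<longleftrightarrow> w \<in> Inl ` nbrs graph_Q q \<union> (if q = A2 then {Inr A2} else {})" for w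
    by (cases w) (auto simp: mem_nbrs H_edge_iff)
  then show "nbrs graph_H (Inl q) = Inl ` nbrs graph_Q q \<union> (if q = A2 then {Inr A2} else {})" by blast
  have "w \<in> nbrs graph_H (Inr q) \<longleftrightarrow> w \<in> Inr ` nbrs graph_Q q \<union> (if q = A2 then {Inl A2} else {})" for w
    by (cases w) (auto simp: mem_nbrs H_edge_iff)
  then show "nbrs graph_H (Inr q) = Inr ` nbrs graph_Q q \<union> (if q = A2 then {Inl A2} else {})" by blast
qed

lemma triangular_H: "triangular graph_H"
  unfolding triangular_def
proof
  fix v :: "qvert + qvert"
  let ?local = "\<lambda>v. \<exists>x y z. distinct [x, y, z] \<and> nbrs graph_H v = {x, y, z} \<and>
     {x, y} \<in> edges graph_H \<and> {x, z} \<notin> edges graph_H \<and> {y, z} \<notin> edges graph_H"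
  have "?local (Inl A2)"
    by (rule exI[of _ "Inl A0"], rule exI[of _ "Inl A1"], rule exI[of _ "Inr A2"])
      (simp add: nbrs_H nbrs_Q H_edge_iff Q_edge_iff insert_commute)
  moreover have "?local (Inr A2)"
    by (rule exI[of _ "Inr A0"], rule exI[of _ "Inr A1"], rule exI[of _ "Inl A2"])
      (simp add: nbrs_H nbrs_Q H_edge_iff Q_edge_iff insert_commute)
  moreover have "?local (Inl q) \<and> ?local (Inr q)" if q: "q \<noteq> A2" for q
  proof -
    obtain x y z where xyz: "distinct [x, y, z]" "nbrs graph_Q q = {x, y, z}"
      "{x, y} \<in> edges graph_Q" "{x, z} \<notin> edges graph_Q" "{y, z} \<notin> edges graph_Q"
      using Q_locally_triangular[OF q] by blast
    have "?local (Inl q)"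
      by (rule exI[of _ "Inl x"], rule exI[of _ "Inl y"], rule exI[of _ "Inl z"])
        (use q xyz in \<open>simp add: nbrs_H H_edge_iff\<close>)
    moreover have "?local (Inr q)"
      by (rule exI[of _ "Inr x"], rule exI[of _ "Inr y"], rule exI[of _ "Inr z"])
        (use q xyz in \<open>simp add: nbrs_H H_edge_iff\<close>)
    ultimately show ?thesis by blast
  qed
  ultimately show "?local v" by (cases v) metis+
qed

lemma verts_Q: "verts graph_Q = UNIV"
  using qvert.exhaust by (auto simp: graph_Q_def)

lemma verts_H: "verts graph_H = UNIV"
  by (simp add: graph_H_def verts_Q UNIV_sum)

lemma simple_graph_H: "simple_graph graph_H"
proof -
  have Q: "\<forall>e\<in>edges graph_Q. \<exists>u v. u \<noteq> v \<and> e = {u, v}"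
    unfolding graph_Q_def by (simp add: doubleton_eq_iff) blast
  show ?thesis unfolding simple_graph_def verts_H
  proof
    fix e assume "e \<in> edges graph_H"
    then consider f where "f \<in> edges graph_Q" "e = Inl ` f" | f where "f \<in> edges graph_Q" "e = Inr ` f"
      | "e = {Inl A2, Inr A2}"
      unfolding graph_H_def by auto
    then show "\<exists>u\<in>UNIV. \<exists>v\<in>UNIV. u \<noteq> v \<and> e = {u, v}"
    proof cases
      case 1
      then obtain u v where "u \<noteq> v" "f = {u, v}" using Q by blast
      with 1 show ?thesis by (intro bexI[of _ "Inl u"] bexI[of _ "Inl v"]) simp_all
    next
      case 2
      then obtain u v where "u \<noteq> v" "f = {u, v}" using Q by blast
      with 2 show ?thesis by (intro bexI[of _ "Inr u"] bexI[of _ "Inr v"]) simp_all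
    next
      case 3
      then show ?thesis by (intro bexI[of _ "Inl A2"] bexI[of _ "Inr A2"]) simp_all
    qed
  qed
qed

lemma finite_UNIV_qvert: "finite (UNIV :: qvert set)" and card_UNIV_qvert: "card (UNIV :: qvert set) = 9"
  unfolding verts_Q[symmetric] by (simp_all add: graph_Q_def)

lemma card_verts_H: "card (verts graph_H) = 18"
  unfolding verts_H UNIV_Plus_UNIV[symmetric] by (subst card_Plus) (simp_all add: finite_UNIV_qvert card_UNIV_qvert)

lemma finite_verts_H: "finite (verts graph_H)"
  using card_verts_H by (intro card_ge_0_finite) simp

text \<open>Every vertex of a copy of Q is reached from the vertex of degree two in that copy, and these
  two vertices are adjacent in H.\<close>

lemma connected_H: "connected_graph graph_H"
proof -
  let ?R = "{(x, y). {x, y} \<in> edges graph_H}"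
  have reach: "(f A2, f q) \<in> ?R\<^sup>*"
    if f: "\<And>u v. {f u, f v} \<in> edges graph_H \<longleftrightarrow> {u, v} \<in> edges graph_Q" for f :: "qvert \<Rightarrow> qvert + qvert" and q
  proof -
    have step: "(f A2, f v) \<in> ?R\<^sup>*" if "(f A2, f u) \<in> ?R\<^sup>*" "v \<in> nbrs graph_Q u" for u v
      using that(1) by (rule rtrancl_into_rtrancl) (use that(2) in \<open>simp add: f Q_edge_iff\<close>)
    have A2: "(f A2, f A2) \<in> ?R\<^sup>*" by simp
    have A0: "(f A2, f A0) \<in> ?R\<^sup>*" by (rule step[OF A2]) (simp add: nbrs_Q)
    have A1: "(f A2, f A1) \<in> ?R\<^sup>*" by (rule step[OF A2]) (simp add: nbrs_Q)
    have B0: "(f A2, f B0) \<in> ?R\<^sup>*" by (rule step[OF A0]) (simp add: nbrs_Q)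
    have C0: "(f A2, f C0) \<in> ?R\<^sup>*" by (rule step[OF A1]) (simp add: nbrs_Q)
    have "(f A2, f B1) \<in> ?R\<^sup>*" "(f A2, f B2) \<in> ?R\<^sup>*" by (rule step[OF B0]; simp add: nbrs_Q)+
    moreover have "(f A2, f C1) \<in> ?R\<^sup>*" "(f A2, f C2) \<in> ?R\<^sup>*" by (rule step[OF C0]; simp add: nbrs_Q)+
    ultimately show ?thesis using A2 A0 A1 B0 C0 by (cases q) simp_all
  qed
  have root: "(Inl A2, v) \<in> ?R\<^sup>*" for v
  proof (cases v)
    case (Inl q) then show ?thesis using reach[of Inl q] by (simp add: H_edge_iff)
  next
    case (Inr q)
    have "(Inl A2, Inr A2) \<in> ?R" by (simp add: H_edge_iff)
    moreover have "(Inr A2, Inr q) \<in> ?R\<^sup>*" using reach[of Inr q] by (simp add: H_edge_iff)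
    ultimately show ?thesis unfolding Inr by (rule converse_rtrancl_into_rtrancl)
  qed
  have "sym ?R" by (auto simp: sym_def insert_commute)
  then have "sym (?R\<^sup>*)" by (rule sym_rtrancl)
  then have "(u, v) \<in> ?R\<^sup>*" for u v
    using root[of u] root[of v] by (meson symD rtrancl_trans)
  then show ?thesis unfolding connected_graph_def verts_H by simp
qed

lemma admissible_H: "admissible graph_H"
proof -
  have "\<not> isomorphic graph_H prism"
  proof
    assume "isomorphic graph_H prism"
    then have "card (verts graph_H) = card (verts prism)"
      unfolding isomorphic_def using bij_betw_same_card by blast
    then show False by (simp add: card_verts_H prism_verts)
  qed
  then show ?thesis
    using simple_graph_H finite_verts_H connected_H triangular_H triangular_iff[OF simple_graph_H]
    unfolding admissible_def by blast
qed

text \<open>A strong coloring of H with seven colors; positions 0 to 8 stand for the vertices of the first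
  copy of Q, in the order in which their datatype lists them, and positions 9 to 17 for those of the
  second copy.\<close>

definition h_matchings :: "(nat \<times> nat) list list" where
  "h_matchings =
  [[(0, 3), (6, 8), (9, 10), (13, 16)],
   [(1, 6), (3, 4), (9, 11), (15, 17)],
   [(4, 7), (0, 1), (10, 11), (12, 13)],
   [(5, 8), (0, 2), (12, 14), (15, 16)],
   [(1, 2), (4, 5), (13, 14), (10, 15)],
   [(3, 5), (6, 7), (2, 11), (14, 17)],
   [(7, 8), (16, 17), (9, 12)]]"

lemma induced_h_matchings: "induced_matchings 18 h_matchings"
  unfolding induced_matchings_def listed_def h_matchings_def by simp

lemma H_7_colorable: "strongly_edge_colorable 7 graph_H"
proof -
  let ?xs = "map Inl [A0, A1, A2, B0, B1, B2, C0, C1, C2] @ map Inr [A0, A1, A2, B0, B1, B2, C0, C1, C2]"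
  have d: "distinct ?xs" by simp
  show ?thesis
  proof (rule strongly_edge_colorable_by_matchings[OF induced_h_matchings d])
    fix e assume "e \<in> edges graph_H"
    then show "\<exists>M\<in>set h_matchings. \<exists>(u, v)\<in>set M. e = {?xs ! u, ?xs ! v}"
      unfolding graph_H_def graph_Q_def select_convs h_matchings_def
        image_insert image_empty Un_insert_left Un_empty_left
      by (elim insertE emptyE) simp_all
  qed (simp_all add: h_matchings_def)
qed

lemma H_not_6_colorable: "\<not> strongly_edge_colorable 6 graph_H"
  by (rule not_strongly_edge_colorable_if_Q[of "Inl A0" "Inl A1" "Inl A2"
      "Inl B0" "Inl B1" "Inl B2" "Inl C0" "Inl C1" "Inl C2"])
    (simp_all add: H_edge_iff Q_edge_iff nbrs_Q)

lemma strong_chromatic_index_H: "strong_chromatic_index graph_H = 7"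
  unfolding strong_chromatic_index_def
proof (rule Least_equality)
  show "strongly_edge_colorable 7 graph_H" by (rule H_7_colorable)
  show "7 \<le> k" if "strongly_edge_colorable k graph_H" for k
    using strongly_edge_colorable_mono[OF that, of 6] H_not_6_colorable by (cases "k \<le> 6") auto
qed

section \<open>Smallest graphs with strong chromatic index seven\<close>

lemma admissible_colorable:
  fixes G :: "'a sgraph"
  assumes G: "admissible G" and small: "card (verts G) < 18"
  shows "strongly_edge_colorable 6 G"
proof -
  interpret triangular_graph G
    using G triangular_iff unfolding admissible_def by unfold_locales blast+
  have fin: "finite (verts G)" and conn: "connected_graph G" and "\<not> isomorphic G prism"
    using G unfolding admissible_def by blast+
  have "card (verts G) \<noteq> 0" using fin conn unfolding connected_graph_def by simp
  moreover have "6 dvd card (verts G)" by (rule six_dvd_card_verts[OF fin])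
  moreover have "card (verts G) \<noteq> 6" using isomorphic_prism \<open>\<not> isomorphic G prism\<close> by blast
  ultimately have card: "card (verts G) = 12" using small by (elim dvdE) simp
  show ?thesis
  proof (cases "\<exists>u\<in>verts G. \<exists>v\<in>block G u. u \<noteq> v \<and> block G (mate G u) = block G (mate G v)")
    case True
    then show ?thesis using colorable_if_double_edge_between_blocks[OF conn card] by blast
  next
    case False
    then show ?thesis using colorable_if_single_edges_between_blocks[OF card] by blast
  qed
qed

theorem proposition4:
  shows "(\<forall>G :: 'a sgraph. admissible G \<and> card (verts G) < 18 \<longrightarrow> strongly_edge_colorable 6 G) \<and>
         admissible graph_H \<and> card (verts graph_H) = 18 \<and> strong_chromatic_index graph_H = 7 \<and>
         (\<forall>G :: 'a sgraph. admissible G \<and> strong_chromatic_index G = 7 \<longrightarrow>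
            card (verts graph_H) \<le> card (verts G))"
proof (intro conjI allI impI)
  show "strongly_edge_colorable 6 G" if "admissible G \<and> card (verts G) < 18" for G :: "'a sgraph"
    using that admissible_colorable by blast
  show "card (verts graph_H) \<le> card (verts G)"
    if G: "admissible G \<and> strong_chromatic_index G = 7" for G :: "'a sgraph"
  proof (rule ccontr)
    assume "\<not> card (verts graph_H) \<le> card (verts G)"
    then have "strongly_edge_colorable 6 G" using G admissible_colorable[of G] by (simp add: card_verts_H)
    then have "strong_chromatic_index G \<le> 6"
      unfolding strong_chromatic_index_def by (rule Least_le)
    then show False using G by simp
  qed
qed (rule admissible_H card_verts_H strong_chromatic_index_H)+

end
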